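(* Let $\mathcal{P}$ be a statistical model on $Z^{\infty}$ equipped with an ATTS sequence of statistics $(S_n)$, let $(A_n)$ be a nonconformity measure, and let $p_n=p_n(\zeta_1,\ldots,\zeta_n,\tau_n)$, $n=1,2,\ldots$, be the corresponding $p$-values. Suppose that the sequence of observations $(\zeta_1,\zeta_2,\ldots)\in Z^{\infty}$ is generated from a probability distribution $P\in\mathcal{P}$ and that the random numbers $(\tau_1,\tau_2,\ldots)\sim U^{\infty}$ are independent of the observations. Then the $p$-values are independent and distributed uniformly on $[0,1]$: $$(p_1,p_2,\ldots)\sim U^{\infty}.$$
   Context: $U$ denotes the uniform distribution on $[0,1]$ and $U^{\infty}$ its infinite product. The observation space $Z$ is a measurable space assumed to be Luzin (so that regular conditional probabilities exist). A statistical model $\mathcal{P}$ on $Z^{\infty}$ is a set of probability distributions on $Z^{\infty}$. Statistics $S_n:Z^n\to\Sigma_n$, $n=1,2,\ldots$, are measurable maps into measurable spaces with $\Sigma_n=S_n(Z^n)$; $\Sigma_0$ is a fixed one-element set (and $S_0$ is the constant with value in $\Sigma_0$). The sequence $(S_n)$ is algebraically transitive if there exist measurable functions $F_n:\Sigma_{n-1}\times Z\to\Sigma_n$, $n=2,3,\ldots$, such that $S_n(\zeta_1,\ldots,\zeta_n)=F_n(S_{n-1}(\zeta_1,\ldots,\zeta_{n-1}),\zeta_n)$ for all $(\zeta_1,\ldots,\zeta_n)\in Z^n$. The sequence $(S_n)$ is totally sufficient for $\mathcal{P}$ if, for each $n=1,2,\ldots$: (i) $S_n$ is sufficient for $\mathcal{P}$,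 i.e., there is a regular conditional distribution of $(\zeta_1,\ldots,\zeta_n)$ given $S_n(\zeta_1,\ldots,\zeta_n)$ that is the same for all $P\in\mathcal{P}$; and (ii) for any $P\in\mathcal{P}$, when $(\zeta_1,\zeta_2,\ldots)\sim P$, the sequences $\zeta_1,\ldots,\zeta_n$ and $\zeta_{n+1},\zeta_{n+2},\ldots$ are conditionally independent given $S_n(\zeta_1,\ldots,\zeta_n)$. An ATTS sequence is a sequence of statistics that is both algebraically transitive and totally sufficient. A nonconformity measure is any sequence of measurable functions $A_n:\Sigma_{n-1}\times Z\to\mathbb{R}$, $n=1,2,\ldots$. Given a nonconformity measure, for $\zeta_1,\zeta_2,\ldots\in Z$ and $\tau_1,\tau_2,\ldots\in[0,1]$ the $p$-values are $$p_n=p_n(\zeta_1,\ldots,\zeta_n,\tau_n):=\Pr\left(A_n^{\mathrm{rnd}}>A_n^{\mathrm{obs}}\mid S_n^{\mathrm{rnd}}=S_n^{\mathrm{obs}}\right)+\tau_n\Pr\left(A_n^{\mathrm{rnd}}=A_n^{\mathrm{obs}}\mid S_n^{\mathrm{rnd}}=S_n^{\mathrm{obs}}\right),$$ where $A_n^{\mathrm{rnd}}:=A_n(S_{n-1}(\xi_1,\ldots,\xi_{n-1}),\xi_n)$, $S_n^{\mathrm{rnd}}:=S_n(\xi_1,\ldots,\xi_n)$ are random, $A_n^{\mathrm{obs}}:=A_n(S_{n-1}(\zeta_1,\ldots,\zeta_{n-1}),\zeta_n)$, $S_n^{\mathrm{obs}}:=S_n(\zeta_1,\ldots,\zeta_n)$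 are the observed values treated as fixed, and the conditional probabilities are over $(\xi_1,\xi_2,\ldots)\sim P$, computed using the fixed common regular conditional distribution given $S_n$ (so they do not depend on $P\in\mathcal{P}$). *)

theory Defs
  imports "HOL-Probability.Probability"
begin

text \<open>
  Observations are indexed from 1: \<open>Z\<close>-valued sequences of length \<open>n\<close> are extensional functions
  on \<open>{1..n}\<close>, infinite ones are extensional functions on \<open>{1..}\<close>.  In particular, the space of
  \<open>Zfin Z 0\<close> has exactly one element.
\<close>

definition Zfin :: "'a measure \<Rightarrow> nat \<Rightarrow> (nat \<Rightarrow> 'a) measure" where
  "Zfin Z n = (\<Pi>\<^sub>M i\<in>{1..n}. Z)"

definition Zinf :: "'a measure \<Rightarrow> (nat \<Rightarrow> 'a) measure" where
  "Zinf Z = (\<Pi>\<^sub>M i\<in>{1..}. Z)"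

definition first_obs :: "nat \<Rightarrow> (nat \<Rightarrow> 'a) \<Rightarrow> nat \<Rightarrow> 'a" where
  "first_obs n z = restrict z {1..n}"

definition later_obs :: "nat \<Rightarrow> (nat \<Rightarrow> 'a) \<Rightarrow> nat \<Rightarrow> 'a" where
  "later_obs n z = restrict z {n<..}"

definition unif :: "real measure" where
  "unif = uniform_measure lborel {0..1}"

definition unif_inf :: "(nat \<Rightarrow> real) measure" where
  "unif_inf = (\<Pi>\<^sub>M i\<in>{1..}. unif)"

text \<open>
  A measurable space is Luzin if it is isomorphic to a Borel subset \<open>H\<close> of a compact metrizable
  space \<open>X\<close> with its Borel \<open>\<sigma>\<close>-algebra.  Compact metrizable spaces have at most the cardinality of
  the continuum, so it is no restriction to take the points of \<open>X\<close> from the type of reals; the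
  topology of \<open>X\<close> is unrelated to the usual one.
\<close>

definition borel_space_on :: "'x topology \<Rightarrow> 'x set \<Rightarrow> 'x measure" where
  "borel_space_on X H = restrict_space (sigma (topspace X) (Collect (openin X))) H"

definition luzin :: "'a measure \<Rightarrow> bool" where
  "luzin Z \<longleftrightarrow>
     (\<exists>X :: real topology. compact_space X \<and> metrizable_space X \<and>
       (\<exists>H \<in> sigma_sets (topspace X) (Collect (openin X)).
         \<exists>f \<in> measurable Z (borel_space_on X H). \<exists>g \<in> measurable (borel_space_on X H) Z.
           (\<forall>z \<in> space Z. g (f z) = z) \<and> (\<forall>h \<in> H. f (g h) = h)))"

definition statistical_model :: "'a measure \<Rightarrow> (nat \<Rightarrow> 'a) measure set \<Rightarrow> bool" where
  "statistical_model Z \<P> \<longleftrightarrow> \<P> \<subseteq> space (prob_algebra (Zinf Z))"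

text \<open>
  For \<open>n = 0\<close> this makes \<open>S 0\<close> the constant map onto the only point of \<open>T 0\<close>.
\<close>

definition statistics :: "'a measure \<Rightarrow> (nat \<Rightarrow> 's measure) \<Rightarrow> (nat \<Rightarrow> (nat \<Rightarrow> 'a) \<Rightarrow> 's) \<Rightarrow> bool" where
  "statistics Z T S \<longleftrightarrow>
     is_singleton (space (T 0)) \<and>
     (\<forall>n. S n \<in> measurable (Zfin Z n) (T n) \<and> S n ` space (Zfin Z n) = space (T n))"

definition algebraically_transitive ::
  "'a measure \<Rightarrow> (nat \<Rightarrow> 's measure) \<Rightarrow> (nat \<Rightarrow> (nat \<Rightarrow> 'a) \<Rightarrow> 's) \<Rightarrow> bool" where
  "algebraically_transitive Z T S \<longleftrightarrow>
     (\<exists>F :: nat \<Rightarrow> 's \<times> 'a \<Rightarrow> 's. \<forall>n\<ge>2.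
        F n \<in> measurable (T (n - 1) \<Otimes>\<^sub>M Z) (T n) \<and>
        (\<forall>z \<in> space (Zfin Z n). S n z = F n (S (n - 1) (first_obs (n - 1) z), z n)))"

definition cond_prob_given ::
  "'w measure \<Rightarrow> 's measure \<Rightarrow> ('w \<Rightarrow> 's) \<Rightarrow> 'w set \<Rightarrow> 'w \<Rightarrow> real" where
  "cond_prob_given M L V E =
     real_cond_exp M (vimage_algebra (space M) V L) (indicator (E \<inter> space M))"

text \<open>
  \<open>K\<close> is a regular conditional distribution of \<open>X\<close> (with values in \<open>N\<close>) given \<open>V\<close> (with values in
  \<open>L\<close>).
\<close>

definition regular_cond_distr ::
  "'w measure \<Rightarrow> 'x measure \<Rightarrow> ('w \<Rightarrow> 'x) \<Rightarrow> 's measure \<Rightarrow> ('w \<Rightarrow> 's) \<Rightarrow> ('s \<Rightarrow> 'x measure) \<Rightarrow> bool" where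
  "regular_cond_distr M N X L V K \<longleftrightarrow>
     X \<in> measurable M N \<and> V \<in> measurable M L \<and> K \<in> measurable L (prob_algebra N) \<and>
     (\<forall>E \<in> sets N. AE w in M. measure (K (V w)) E = cond_prob_given M L V (X -` E) w)"

definition cond_indep_var ::
  "'w measure \<Rightarrow> 'x measure \<Rightarrow> ('w \<Rightarrow> 'x) \<Rightarrow> 'y measure \<Rightarrow> ('w \<Rightarrow> 'y) \<Rightarrow> 's measure \<Rightarrow> ('w \<Rightarrow> 's) \<Rightarrow> bool" where
  "cond_indep_var M N X N' Y L V \<longleftrightarrow>
     X \<in> measurable M N \<and> Y \<in> measurable M N' \<and> V \<in> measurable M L \<and>
     (\<forall>E \<in> sets N. \<forall>E' \<in> sets N'. AE w in M.
        cond_prob_given M L V (X -` E \<inter> Y -` E') w =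
        cond_prob_given M L V (X -` E) w * cond_prob_given M L V (Y -` E') w)"

text \<open>
  The library's \<open>indep_var\<close> requires both random elements to take values in the same type.
\<close>

definition indep_elements ::
  "'w measure \<Rightarrow> 'x measure \<Rightarrow> ('w \<Rightarrow> 'x) \<Rightarrow> 'y measure \<Rightarrow> ('w \<Rightarrow> 'y) \<Rightarrow> bool" where
  "indep_elements M N X N' Y \<longleftrightarrow>
     X \<in> measurable M N \<and> Y \<in> measurable M N' \<and>
     prob_space.indep_set M (sets (vimage_algebra (space M) X N)) (sets (vimage_algebra (space M) Y N'))"

definition common_cond_distr ::
  "'a measure \<Rightarrow> (nat \<Rightarrow> 'a) measure set \<Rightarrow> (nat \<Rightarrow> 's measure) \<Rightarrow> (nat \<Rightarrow> (nat \<Rightarrow> 'a) \<Rightarrow> 's) \<Rightarrow>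
    nat \<Rightarrow> ('s \<Rightarrow> (nat \<Rightarrow> 'a) measure) \<Rightarrow> bool" where
  "common_cond_distr Z \<P> T S n K \<longleftrightarrow>
     K \<in> measurable (T n) (prob_algebra (Zfin Z n)) \<and>
     (\<forall>P \<in> \<P>. regular_cond_distr P (Zfin Z n) (first_obs n) (T n) (\<lambda>z. S n (first_obs n z)) K)"

definition sufficient ::
  "'a measure \<Rightarrow> (nat \<Rightarrow> 'a) measure set \<Rightarrow> (nat \<Rightarrow> 's measure) \<Rightarrow> (nat \<Rightarrow> (nat \<Rightarrow> 'a) \<Rightarrow> 's) \<Rightarrow>
    nat \<Rightarrow> bool" where
  "sufficient Z \<P> T S n \<longleftrightarrow> (\<exists>K. common_cond_distr Z \<P> T S n K)"

definition totally_sufficient ::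
  "'a measure \<Rightarrow> (nat \<Rightarrow> 'a) measure set \<Rightarrow> (nat \<Rightarrow> 's measure) \<Rightarrow> (nat \<Rightarrow> (nat \<Rightarrow> 'a) \<Rightarrow> 's) \<Rightarrow> bool" where
  "totally_sufficient Z \<P> T S \<longleftrightarrow>
     (\<forall>n\<ge>1. sufficient Z \<P> T S n \<and>
        (\<forall>P \<in> \<P>. cond_indep_var P
           (Zfin Z n) (first_obs n) (\<Pi>\<^sub>M i\<in>{n<..}. Z) (later_obs n) (T n) (\<lambda>z. S n (first_obs n z))))"

definition ATTS ::
  "'a measure \<Rightarrow> (nat \<Rightarrow> 'a) measure set \<Rightarrow> (nat \<Rightarrow> 's measure) \<Rightarrow> (nat \<Rightarrow> (nat \<Rightarrow> 'a) \<Rightarrow> 's) \<Rightarrow> bool" where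
  "ATTS Z \<P> T S \<longleftrightarrow>
     statistics Z T S \<and> algebraically_transitive Z T S \<and> totally_sufficient Z \<P> T S"

definition nonconformity_measure ::
  "'a measure \<Rightarrow> (nat \<Rightarrow> 's measure) \<Rightarrow> (nat \<Rightarrow> 's \<times> 'a \<Rightarrow> real) \<Rightarrow> bool" where
  "nonconformity_measure Z T A \<longleftrightarrow> (\<forall>n\<ge>1. A n \<in> borel_measurable (T (n - 1) \<Otimes>\<^sub>M Z))"

definition nonconformity_score ::
  "(nat \<Rightarrow> (nat \<Rightarrow> 'a) \<Rightarrow> 's) \<Rightarrow> (nat \<Rightarrow> 's \<times> 'a \<Rightarrow> real) \<Rightarrow> nat \<Rightarrow> (nat \<Rightarrow> 'a) \<Rightarrow> real" where
  "nonconformity_score S A n z = A n (S (n - 1) (first_obs (n - 1) z), z n)"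

text \<open>
  \<open>K n\<close> is meant to be the chosen common regular conditional distribution of the first \<open>n\<close>
  observations given \<open>S n\<close>; the conditional probabilities given \<open>S n = s\<close> are computed as
  probabilities under \<open>K n s\<close>.
\<close>

definition p_value ::
  "'a measure \<Rightarrow> (nat \<Rightarrow> (nat \<Rightarrow> 'a) \<Rightarrow> 's) \<Rightarrow> (nat \<Rightarrow> 's \<Rightarrow> (nat \<Rightarrow> 'a) measure) \<Rightarrow>
    (nat \<Rightarrow> 's \<times> 'a \<Rightarrow> real) \<Rightarrow> nat \<Rightarrow> (nat \<Rightarrow> 'a) \<Rightarrow> real \<Rightarrow> real" where
  "p_value Z S K A n z t =
     (let Q = K n (S n (first_obs n z)); a = nonconformity_score S A n z in
        measure Q {x \<in> space (Zfin Z n). nonconformity_score S A n x > a} +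
        t * measure Q {x \<in> space (Zfin Z n). nonconformity_score S A n x = a})"

end

theory Submission
  imports Defs
begin

text \<open>
  The p-values are independent because of an argument in reverse time.  Fix \<open>n\<close> and condition on
  the statistic of the first \<open>n\<close> observations together with all later observations and random
  numbers.  Conditional independence says that the first \<open>n\<close> observations still have the
  distribution \<open>K n s\<close>, where \<open>s\<close> is the value of the statistic
  (\<open>joint_law_disintegration\<close>).  The p-value compares the observed nonconformity
  score with this same distribution and randomizes over ties, so it is conditionally uniform by the
  randomized probability integral transform (\<open>distr_smoothed_p_value\<close>).  Its conditional
  distribution does not depend on the condition, hence the p-value is uniform and independent of the later
  data (\<open>smoothed_p_value_uniform_given_later\<close>).

  On the other hand, algebraic transitivity makes every later p-value a function of these same later data
  (\<open>later_p_values_determined\<close>): the statistics after step \<open>n\<close> can be updated from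
  \<open>S n\<close> with the later observations, without going back to the first \<open>n\<close> ones.  So the p-value
  at \<open>n\<close> is independent of all those after it.  Peeling off the p-values one at a time gives the
  product formula on every finite window, which determines the law of the whole sequence.
\<close>

section \<open>Measures on product spaces\<close>

text \<open>
  Rectangles form an intersection-stable generator of the product \<open>\<sigma>\<close>-algebra, and the whole space is
  itself a rectangle, of finite measure.
\<close>

lemma measure_eqI_rectangles:
  assumes M: "sets M = sets (A \<Otimes>\<^sub>M B)" and N: "sets N = sets (A \<Otimes>\<^sub>M B)"
    and fin: "finite_measure M"
    and eq: "\<And>a b. a \<in> sets A \<Longrightarrow> b \<in> sets B \<Longrightarrow> emeasure M (a \<times> b) = emeasure N (a \<times> b)"
  shows "M = N"
proof (rule measure_eqI_generator_eq[OF Int_stable_pair_measure_generator[of A B]])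
  show "{a \<times> b |a b. a \<in> sets A \<and> b \<in> sets B} \<subseteq> Pow (space A \<times> space B)"
    by (rule pair_measure_closed)
  show "emeasure M X = emeasure N X" if "X \<in> {a \<times> b |a b. a \<in> sets A \<and> b \<in> sets B}" for X
    using that eq by auto
  show "sets M = sigma_sets (space A \<times> space B) {a \<times> b |a b. a \<in> sets A \<and> b \<in> sets B}"
    "sets N = sigma_sets (space A \<times> space B) {a \<times> b |a b. a \<in> sets A \<and> b \<in> sets B}"
    using M N by (simp_all add: sets_pair_measure)
  show "range (\<lambda>i::nat. space A \<times> space B) \<subseteq> {a \<times> b |a b. a \<in> sets A \<and> b \<in> sets B}"
    "(\<Union>i::nat. space A \<times> space B) = space A \<times> space B"
    by auto
  show "emeasure M (space A \<times> space B) \<noteq> \<infinity>"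
    using finite_measure.emeasure_finite[OF fin] by simp
qed

text \<open>
  Only the coordinates in \<open>insert i J\<close> matter, and on those the map is inverse to inserting the coordinate
  \<open>i\<close>, which is known to preserve product measures.
\<close>

lemma distr_PiM_split_component:
  assumes U: "prob_space U" and i: "i \<notin> J" and I: "insert i J \<subseteq> I"
  shows "distr (\<Pi>\<^sub>M j\<in>I. U) (U \<Otimes>\<^sub>M (\<Pi>\<^sub>M j\<in>J. U)) (\<lambda>t. (t i, restrict t J)) = U \<Otimes>\<^sub>M (\<Pi>\<^sub>M j\<in>J. U)"
proof -
  let ?P = "\<lambda>J. \<Pi>\<^sub>M j\<in>J. U" and ?split = "\<lambda>t. (t i, restrict t J)"
  have split [measurable]: "?split \<in> measurable (?P (insert i J)) (U \<Otimes>\<^sub>M ?P J)"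
    by (intro measurable_Pair measurable_component_singleton measurable_restrict_subset) auto
  have restr [measurable]: "(\<lambda>t. restrict t (insert i J)) \<in> measurable (?P I) (?P (insert i J))"
    using I by (intro measurable_restrict_subset)
  have upd [measurable]: "(\<lambda>(x, t). t(i := x)) \<in> measurable (U \<Otimes>\<^sub>M ?P J) (?P (insert i J))"
    unfolding case_prod_beta' by (intro measurable_fun_upd[where J=J]) auto
  have "?P (insert i J) = distr (?P I) (?P (insert i J)) (\<lambda>t. restrict t (insert i J))"
    by (rule distr_PiM_reindex[of I "\<lambda>_. U" "\<lambda>j. j" "insert i J", symmetric]) (use U I in auto)
  then have "distr (?P (insert i J)) (U \<Otimes>\<^sub>M ?P J) ?split
      = distr (distr (?P I) (?P (insert i J)) (\<lambda>t. restrict t (insert i J))) (U \<Otimes>\<^sub>M ?P J) ?split"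
    by simp
  also have "\<dots> = distr (?P I) (U \<Otimes>\<^sub>M ?P J) ?split"
    by (subst distr_distr[OF split restr]) (auto intro!: distr_cong simp: restrict_def fun_eq_iff)
  finally have "distr (?P I) (U \<Otimes>\<^sub>M ?P J) ?split = distr (?P (insert i J)) (U \<Otimes>\<^sub>M ?P J) ?split" ..
  also have "\<dots> = distr (distr (U \<Otimes>\<^sub>M ?P J) (?P (insert i J)) (\<lambda>(x, t). t(i := x))) (U \<Otimes>\<^sub>M ?P J) ?split"
    using distr_pair_PiM_eq_PiM[of J "\<lambda>_. U" i] U by simp
  also have "\<dots> = distr (U \<Otimes>\<^sub>M ?P J) (U \<Otimes>\<^sub>M ?P J) (\<lambda>x. x)"
    by (subst distr_distr[OF split upd], intro distr_cong refl)
       (auto simp: space_pair_measure space_PiM i PiE_def extensional_def restrict_def fun_eq_iff)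
  also have "\<dots> = U \<Otimes>\<^sub>M ?P J"
    by simp
  finally show ?thesis .
qed

lemma distr_indep_elements:
  assumes M: "prob_space M" and ind: "indep_elements M N X N' Y"
  shows "distr M (N \<Otimes>\<^sub>M N') (\<lambda>w. (X w, Y w)) = distr M N X \<Otimes>\<^sub>M distr M N' Y"
proof (rule measure_eqI_rectangles)
  interpret prob_space M by fact
  have X [measurable]: "X \<in> measurable M N" and Y [measurable]: "Y \<in> measurable M N'"
    and ind': "indep_set (sets (vimage_algebra (space M) X N)) (sets (vimage_algebra (space M) Y N'))"
    using ind by (auto simp: indep_elements_def)
  interpret Y: prob_space "distr M N' Y" by (rule prob_space_distr[OF Y])
  show "sets (distr M (N \<Otimes>\<^sub>M N') (\<lambda>w. (X w, Y w))) = sets (N \<Otimes>\<^sub>M N')"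
    "sets (distr M N X \<Otimes>\<^sub>M distr M N' Y) = sets (N \<Otimes>\<^sub>M N')"
    by simp_all
  show "finite_measure (distr M (N \<Otimes>\<^sub>M N') (\<lambda>w. (X w, Y w)))"
    by (rule finite_measure_distr) measurable
  fix a b assume a [measurable]: "a \<in> sets N" and b [measurable]: "b \<in> sets N'"
  have "emeasure (distr M (N \<Otimes>\<^sub>M N') (\<lambda>w. (X w, Y w))) (a \<times> b)
      = emeasure M ((X -` a \<inter> space M) \<inter> (Y -` b \<inter> space M))"
    by (subst emeasure_distr) (auto intro!: arg_cong[where f="emeasure M"])
  also have "\<dots> = emeasure M (X -` a \<inter> space M) * emeasure M (Y -` b \<inter> space M)"
    using indep_setD[OF ind' in_vimage_algebra[OF a] in_vimage_algebra[OF b]]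
    by (simp add: emeasure_eq_measure ennreal_mult)
  also have "\<dots> = emeasure (distr M N X \<Otimes>\<^sub>M distr M N' Y) (a \<times> b)"
    by (subst Y.emeasure_pair_measure_Times) (simp_all add: emeasure_distr)
  finally show "emeasure (distr M (N \<Otimes>\<^sub>M N') (\<lambda>w. (X w, Y w))) (a \<times> b)
      = emeasure (distr M N X \<Otimes>\<^sub>M distr M N' Y) (a \<times> b)" .
qed

section \<open>The randomized probability integral transform\<close>

lemma prob_space_unif: "prob_space unif"
  unfolding unif_def by (rule prob_space_uniform_measure) auto

lemma sets_unif [measurable_cong, simp]: "sets unif = sets borel"
  by (simp add: unif_def)

lemma space_unif [simp]: "space unif = UNIV"
  by (simp add: unif_def)

lemma AE_unif: "AE t in unif. 0 \<le> t \<and> t \<le> 1"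
  unfolding unif_def by (rule AE_uniform_measureI) auto

lemma measure_unif_atMost: "0 \<le> d \<Longrightarrow> d \<le> 1 \<Longrightarrow> measure unif {..d} = d"
proof -
  assume d: "0 \<le> d" "d \<le> 1"
  then have *: "{0..1} \<inter> {..d} = {0..d}" by auto
  have "emeasure unif {..d} = ennreal d"
    unfolding unif_def using d by (subst emeasure_uniform_measure) (auto simp: * divide_ennreal_def)
  then show ?thesis using d by (simp add: measure_def)
qed

text \<open>
  The value at score \<open>c\<close> of the upper tail function of \<open>f\<close> under \<open>Q\<close>, where a jump at \<open>c\<close> is
  interpolated linearly by \<open>t\<close>.  This is the form that all the p-values of the theorem share.
\<close>

definition smoothed_p_value :: "'x measure \<Rightarrow> ('x \<Rightarrow> real) \<Rightarrow> real \<Rightarrow> real \<Rightarrow> real" where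
  "smoothed_p_value Q f c t =
     measure Q {y \<in> space Q. f y > c} + t * measure Q {y \<in> space Q. f y = c}"

text \<open>
  Along a sequence of observations the reference distribution, the observed score and the random
  number all vary, so measurability is needed jointly in the three of them.
\<close>

lemma measurable_smoothed_p_value [measurable]:
  assumes K: "K \<in> measurable L (prob_algebra N)" and f [measurable]: "f \<in> borel_measurable N"
    and v [measurable]: "v \<in> measurable R L"
    and c [measurable]: "c \<in> borel_measurable R" and t [measurable]: "t \<in> borel_measurable R"
  shows "(\<lambda>r. smoothed_p_value (K (v r)) f (c r) (t r)) \<in> borel_measurable R"
proof -
  have Kv [measurable]: "(\<lambda>r. K (v r)) \<in> measurable R (prob_algebra N)"
    using measurable_compose[OF v K] .
  have sp: "space (K (v r)) = space N" if "r \<in> space R" for r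
    using measurable_space[OF Kv that] by (auto simp: space_prob_algebra dest: sets_eq_imp_space_eq)
  have "(\<lambda>r. measure (K (v r)) {y \<in> space N. f y > c r}
      + t r * measure (K (v r)) {y \<in> space N. f y = c r}) \<in> borel_measurable R"
  proof (intro borel_measurable_add borel_measurable_times t measure_measurable_prob_algebra2[OF _ Kv])
    have "(SIGMA r:space R. {y \<in> space N. c r < f y})
        = {x \<in> space (R \<Otimes>\<^sub>M N). c (fst x) < f (snd x)}" by (auto simp: space_pair_measure)
    then show "(SIGMA r:space R. {y \<in> space N. c r < f y}) \<in> sets (R \<Otimes>\<^sub>M N)" by simp
    have "(SIGMA r:space R. {y \<in> space N. f y = c r})
        = {x \<in> space (R \<Otimes>\<^sub>M N). f (snd x) = c (fst x)}" by (auto simp: space_pair_measure)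
    then show "(SIGMA r:space R. {y \<in> space N. f y = c r}) \<in> sets (R \<Otimes>\<^sub>M N)" by simp
  qed
  then show ?thesis
    by (rule measurable_cong[THEN iffD1, rotated]) (simp add: smoothed_p_value_def sp)
qed

text \<open>
  The quantile at level \<open>1 - u\<close> works: below it the distribution function stays under \<open>1 - u\<close>, and
  right continuity of the distribution function gives the first bound at the quantile itself.
\<close>

lemma (in prob_space) upper_quantile_exists:
  fixes f :: "'a \<Rightarrow> real"
  assumes f [measurable]: "f \<in> borel_measurable M" and u: "0 < u" "u < 1"
  obtains c where "prob {y \<in> space M. f y > c} \<le> u" "u \<le> prob {y \<in> space M. f y \<ge> c}"
    "\<And>a. a < c \<Longrightarrow> u < prob {y \<in> space M. f y > a}"
proof -
  interpret D: cdf_distribution "distr M borel f"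
    unfolding cdf_distribution_def by simp
  define c where "c = D.I (1 - u)"
  have iff: "1 - u \<le> D.C x \<longleftrightarrow> c \<le> x" for x
    unfolding c_def using u by (intro D.pseudoinverse) auto
  have cdf: "D.C x = prob {y \<in> space M. f y \<le> x}" for x
    unfolding cdf_def by (subst measure_distr) (auto intro!: arg_cong[where f=prob])
  have cdf': "D.C x = 1 - prob {y \<in> space M. f y > x}" for x
    unfolding cdf by (subst prob_compl[symmetric]) (auto intro!: arg_cong[where f=prob])
  \<comment> \<open>The mass strictly below \<open>c\<close> is the left limit of the distribution function at \<open>c\<close>.\<close>
  have le: "measure (distr M borel f) {..<c} \<le> 1 - u"
  proof (rule tendsto_upperbound[OF D.cdf_at_left])
    show "\<forall>\<^sub>F x in at_left c. D.C x \<le> 1 - u"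
    proof -
      have "\<forall>\<^sub>F x in at_left c. x < c" by (simp add: eventually_at_filter)
      then show ?thesis
      proof eventually_elim
        case (elim x)
        with iff[of x] show ?case by linarith
      qed
    qed
  qed simp
  have "prob {y \<in> space M. f y < c} \<le> 1 - u"
    using le by (subst (asm) measure_distr) (auto simp: vimage_def Int_def conj_commute)
  moreover have "prob {y \<in> space M. f y < c} = 1 - prob {y \<in> space M. f y \<ge> c}"
    by (subst prob_compl[symmetric]) (auto intro!: arg_cong[where f=prob])
  ultimately have 2: "u \<le> prob {y \<in> space M. f y \<ge> c}" by simp
  have 1: "prob {y \<in> space M. f y > c} \<le> u" using iff[of c] by (simp add: cdf')
  have 3: "u < prob {y \<in> space M. f y > a}" if "a < c" for a
    using iff[of a] that by (simp add: cdf')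
  show thesis using that[OF 1 2 3] .
qed

lemma (in prob_space) smoothed_p_value_bounds:
  assumes [measurable]: "f \<in> borel_measurable M" and t: "0 \<le> t" "t \<le> 1"
  shows "prob {y \<in> space M. f y > c} \<le> smoothed_p_value M f c t"
    and "smoothed_p_value M f c t \<le> prob {y \<in> space M. f y \<ge> c}"
proof -
  have "prob {y \<in> space M. f y \<ge> c} = prob {y \<in> space M. f y > c} + prob {y \<in> space M. f y = c}"
    by (subst finite_measure_Union[symmetric]) (auto intro!: arg_cong[where f=prob])
  moreover have "t * prob {y \<in> space M. f y = c} \<le> 1 * prob {y \<in> space M. f y = c}"
    using t by (intro mult_right_mono) auto
  ultimately show "prob {y \<in> space M. f y > c} \<le> smoothed_p_value M f c t"
    "smoothed_p_value M f c t \<le> prob {y \<in> space M. f y \<ge> c}"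
    using t by (auto simp: smoothed_p_value_def)
qed

text \<open>
  Let \<open>c\<close> be the upper quantile at level \<open>u\<close>.  For random numbers in the unit interval, scores above \<open>c\<close>
  always give a value at most \<open>u\<close>, scores below \<open>c\<close> always a larger one, and at \<open>c\<close> itself the random number decides.  If \<open>q\<close> is the mass of
  the jump at \<open>c\<close>, the share of random numbers that decide for \<open>\<le> u\<close> is the fraction of the jump which
  fills the gap between the mass above \<open>c\<close> and \<open>u\<close>.
\<close>

lemma (in prob_space) smoothed_p_value_le_level:
  assumes f [measurable]: "f \<in> borel_measurable M" and u: "0 < u" "u < 1"
  shows "measure (M \<Otimes>\<^sub>M unif) {w \<in> space (M \<Otimes>\<^sub>M unif). smoothed_p_value M f (f (fst w)) (snd w) \<le> u} = u"
proof -
  interpret U: prob_space unif by (rule prob_space_unif)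
  interpret MU: pair_prob_space M unif ..
  obtain c where c: "prob {y \<in> space M. f y > c} \<le> u" "u \<le> prob {y \<in> space M. f y \<ge> c}"
    "\<And>a. a < c \<Longrightarrow> u < prob {y \<in> space M. f y > a}"
    using upper_quantile_exists[OF f u] by blast
  define q where "q = prob {y \<in> space M. f y = c}"
  define d where "d = u - prob {y \<in> space M. f y > c}"
  have "prob {y \<in> space M. f y \<ge> c} = prob {y \<in> space M. f y > c} + q"
    unfolding q_def by (subst finite_measure_Union[symmetric]) (auto intro!: arg_cong[where f=prob])
  with c have d: "0 \<le> d" "d \<le> q" by (auto simp: d_def)
  have [measurable]: "(\<lambda>w. smoothed_p_value M f (f (fst w)) (snd w)) \<in> borel_measurable (M \<Otimes>\<^sub>M unif)"
    by (rule measurable_smoothed_p_value[where K="\<lambda>_. M" and L="count_space UNIV" and N=M and v="\<lambda>_. ()"])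
       (auto simp: space_prob_algebra prob_space_axioms)
  have AE: "AE w in M \<Otimes>\<^sub>M unif. 0 \<le> snd w \<and> snd w \<le> 1"
  proof (rule MU.AE_pair_measure)
    show "{w \<in> space (M \<Otimes>\<^sub>M unif). 0 \<le> snd w \<and> snd w \<le> 1} \<in> sets (M \<Otimes>\<^sub>M unif)"
      by measurable
    show "AE x in M. AE t in unif. 0 \<le> snd (x, t) \<and> snd (x, t) \<le> 1"
      using AE_unif by simp
  qed
  have iff: "smoothed_p_value M f (f x) t \<le> u \<longleftrightarrow> f x > c \<or> (f x = c \<and> t * q \<le> d)"
    if "0 \<le> t" "t \<le> 1" for x t
  proof (cases "f x" c rule: linorder_cases)
    case less
    with c(3)[of "f x"] smoothed_p_value_bounds(1)[OF f that, of "f x"] show ?thesis by auto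
  next
    case equal
    then show ?thesis by (auto simp: smoothed_p_value_def q_def d_def)
  next
    case greater
    have "prob {y \<in> space M. f y \<ge> f x} \<le> prob {y \<in> space M. f y > c}"
      using greater by (intro finite_measure_mono) auto
    with c(1) smoothed_p_value_bounds(2)[OF f that, of "f x"] greater show ?thesis by auto
  qed
  let ?U = "{t. t * q \<le> d}"
  have U [measurable]: "?U \<in> sets unif" by measurable
  \<comment> \<open>Without a jump the gap \<open>d\<close> is zero as well, so nothing has to be filled.\<close>
  have qU: "q * U.prob ?U = d"
  proof (cases "q = 0")
    case True
    with d show ?thesis by auto
  next
    case False
    then have "q > 0" by (simp add: q_def zero_less_measure_iff)
    then have "?U = {..d / q}" by (auto simp: field_simps)
    with \<open>q > 0\<close> d show ?thesis using measure_unif_atMost[of "d / q"] by simp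
  qed
  have "measure (M \<Otimes>\<^sub>M unif) {w \<in> space (M \<Otimes>\<^sub>M unif). smoothed_p_value M f (f (fst w)) (snd w) \<le> u}
      = measure (M \<Otimes>\<^sub>M unif) ({y \<in> space M. f y > c} \<times> space unif \<union> {y \<in> space M. f y = c} \<times> ?U)"
    using AE by (intro MU.finite_measure_eq_AE) (auto simp: iff space_pair_measure)
  also have "\<dots> = measure (M \<Otimes>\<^sub>M unif) ({y \<in> space M. f y > c} \<times> space unif)
      + measure (M \<Otimes>\<^sub>M unif) ({y \<in> space M. f y = c} \<times> ?U)"
    by (rule MU.finite_measure_Union) auto
  also have "\<dots> = prob {y \<in> space M. f y > c} + q * U.prob ?U"
    using U.emeasure_space_1
    by (simp add: q_def measure_def U.emeasure_pair_measure_Times enn2real_mult)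
  finally show ?thesis using qU by (simp add: d_def)
qed

text \<open>
  The randomized probability integral transform.  The interior levels give the distribution function;
  level 0 is the limit of small levels, and level 1 holds because the values almost surely do not exceed 1.
\<close>

lemma (in prob_space) distr_smoothed_p_value:
  assumes f [measurable]: "f \<in> borel_measurable M"
  shows "distr (M \<Otimes>\<^sub>M unif) unif (\<lambda>w. smoothed_p_value M f (f (fst w)) (snd w)) = unif"
proof -
  interpret U: prob_space unif by (rule prob_space_unif)
  interpret MU: pair_prob_space M unif ..
  let ?p = "\<lambda>w. smoothed_p_value M f (f (fst w)) (snd w)"
  have p [measurable]: "?p \<in> borel_measurable (M \<Otimes>\<^sub>M unif)"
    by (rule measurable_smoothed_p_value[where K="\<lambda>_. M" and L="count_space UNIV" and N=M and v="\<lambda>_. ()"])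
       (auto simp: space_prob_algebra prob_space_axioms)
  have level: "measure (M \<Otimes>\<^sub>M unif) {w \<in> space (M \<Otimes>\<^sub>M unif). ?p w \<le> u} = u" if u01: "0 \<le> u" "u \<le> 1" for u
  proof -
    consider "u = 0" | "0 < u" "u < 1" | "u = 1" using u01 by linarith
    then show ?thesis
    proof cases
      case 1
      have "measure (M \<Otimes>\<^sub>M unif) {w \<in> space (M \<Otimes>\<^sub>M unif). ?p w \<le> 0} \<le> 0"
      proof (rule field_le_epsilon)
        fix e :: real assume "0 < e"
        have "measure (M \<Otimes>\<^sub>M unif) {w \<in> space (M \<Otimes>\<^sub>M unif). ?p w \<le> 0}
            \<le> measure (M \<Otimes>\<^sub>M unif) {w \<in> space (M \<Otimes>\<^sub>M unif). ?p w \<le> min e (1/2)}"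
        proof (rule MU.finite_measure_mono)
          show "{w \<in> space (M \<Otimes>\<^sub>M unif). ?p w \<le> 0} \<subseteq> {w \<in> space (M \<Otimes>\<^sub>M unif). ?p w \<le> min e (1/2)}"
            using \<open>0 < e\<close> by auto
          show "{w \<in> space (M \<Otimes>\<^sub>M unif). ?p w \<le> min e (1/2)} \<in> sets (M \<Otimes>\<^sub>M unif)"
            by measurable
        qed
        also have "\<dots> = min e (1/2)"
          using \<open>0 < e\<close> by (intro smoothed_p_value_le_level) auto
        finally show "measure (M \<Otimes>\<^sub>M unif) {w \<in> space (M \<Otimes>\<^sub>M unif). ?p w \<le> 0} \<le> 0 + e" by simp
      qed
      with 1 show ?thesis by (simp add: antisym)
    next
      case 2
      then show ?thesis by (rule smoothed_p_value_le_level[OF f])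
    next
      case 3
      have "AE w in M \<Otimes>\<^sub>M unif. 0 \<le> snd w \<and> snd w \<le> 1"
    proof (rule MU.AE_pair_measure)
    show "{w \<in> space (M \<Otimes>\<^sub>M unif). 0 \<le> snd w \<and> snd w \<le> 1} \<in> sets (M \<Otimes>\<^sub>M unif)"
      by measurable
    show "AE x in M. AE t in unif. 0 \<le> snd (x, t) \<and> snd (x, t) \<le> 1"
      using AE_unif by simp
  qed
      then have "AE w in M \<Otimes>\<^sub>M unif. ?p w \<le> 1"
        by eventually_elim (auto intro: order_trans[OF smoothed_p_value_bounds(2)[OF f]])
      then have "measure (M \<Otimes>\<^sub>M unif) {w \<in> space (M \<Otimes>\<^sub>M unif). ?p w \<le> 1} = 1"
        by (intro iffD2[OF MU.prob_Collect_eq_1]) measurable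
      with 3 show ?thesis by simp
    qed
  qed
  have "distributed (M \<Otimes>\<^sub>M unif) lborel ?p (\<lambda>x. indicator {0..1} x / measure lborel {0..1::real})"
    by (rule MU.uniform_distrI_borel_atLeastAtMost) (auto simp: level)
  then have "distr (M \<Otimes>\<^sub>M unif) lborel ?p = density lborel (\<lambda>x. ennreal (indicator {0..1} x / measure lborel {0..1::real}))"
    by (rule distributed_distr_eq_density)
  also have "\<dots> = unif"
    unfolding unif_def uniform_measure_def by (auto intro!: density_cong simp: split: split_indicator)
  finally show ?thesis by (simp cong: distr_cong)
qed

section \<open>Disintegration under conditional independence\<close>

text \<open>
  The defining property of a conditional probability, in the form in which a weight that is a function of
  the condition can be moved into and out of it.
\<close>

lemma cond_prob_given_integral:
  assumes P: "prob_space P" and V [measurable]: "V \<in> measurable P L" and E: "E \<inter> space P \<in> sets P"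
    and g [measurable]: "g \<in> borel_measurable L" and bdd: "\<And>s. s \<in> space L \<Longrightarrow> \<bar>g s\<bar> \<le> 1"
  shows "cond_prob_given P L V E \<in> borel_measurable P"
    and "(\<integral>w. g (V w) * cond_prob_given P L V E w \<partial>P) = (\<integral>w. g (V w) * indicator (E \<inter> space P) w \<partial>P)"
proof -
  interpret P: prob_space P by fact
  let ?F = "vimage_algebra (space P) V L"
  have Vsp: "V \<in> space P \<rightarrow> space L" using measurable_space[OF V] by auto
  have sub: "subalgebra P ?F"
    unfolding subalgebra_def using V Vsp by (auto simp: sets_vimage_algebra2)
  interpret finite_measure_subalgebra P ?F
    by standard (rule sub)
  note E [measurable]
  have gV: "(\<lambda>w. g (V w)) \<in> borel_measurable ?F"
    using measurable_compose[OF measurable_vimage_algebra1[OF Vsp] g] .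
  have int: "integrable P (\<lambda>w. g (V w) * indicator (E \<inter> space P) w)"
    using bdd measurable_space[OF V]
    by (intro P.integrable_const_bound[where B=1]) (auto split: split_indicator)
  show "cond_prob_given P L V E \<in> borel_measurable P"
    unfolding cond_prob_given_def by simp
  show "(\<integral>w. g (V w) * cond_prob_given P L V E w \<partial>P) = (\<integral>w. g (V w) * indicator (E \<inter> space P) w \<partial>P)"
    unfolding cond_prob_given_def using real_cond_exp_intg(2)[OF int gV] by simp
qed

text \<open>
  Condition on \<open>V\<close>, factor the conditional probability of \<open>X \<in> E\<close> and \<open>Y \<in> E'\<close>, replace the first
  factor by \<open>K (V w) E\<close>, and then take the second conditional expectation back, which is possible because
  the remaining weight is a function of \<open>V\<close> alone.
\<close>

lemma kernel_measure_eq_joint_prob: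
  assumes P: "prob_space P"
    and rcd: "regular_cond_distr P N X L V K"
    and ci: "cond_indep_var P N X N' Y L V"
    and E: "E \<in> sets N" and D: "D \<in> sets L" and E': "E' \<in> sets N'"
  shows "measure P {w \<in> space P. X w \<in> E \<and> V w \<in> D \<and> Y w \<in> E'}
    = (\<integral>w. measure (K (V w)) E * indicator (D \<times> E') (V w, Y w) \<partial>P)"
proof -
  interpret P: prob_space P by fact
  have X [measurable]: "X \<in> measurable P N" and V [measurable]: "V \<in> measurable P L"
    and Y [measurable]: "Y \<in> measurable P N'" and K: "K \<in> measurable L (prob_algebra N)"
    using rcd ci by (auto simp: regular_cond_distr_def cond_indep_var_def)
  note E [measurable] and D [measurable] and E' [measurable]
  have sets: "X -` E \<inter> Y -` E' \<inter> space P \<in> sets P" "Y -` E' \<inter> space P \<in> sets P"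
  proof -
    have "X -` E \<inter> Y -` E' \<inter> space P = {w \<in> space P. X w \<in> E \<and> Y w \<in> E'}" by auto
    then show "X -` E \<inter> Y -` E' \<inter> space P \<in> sets P" by simp
    show "Y -` E' \<inter> space P \<in> sets P" by (rule measurable_sets[OF Y E'])
  qed
  define k where "k s = measure (K s) E" for s
  have k [measurable]: "k \<in> borel_measurable L"
    unfolding k_def using measurable_compose[OF K measurable_measure_prob_algebra[OF E]] .
  have k1: "\<bar>k s\<bar> \<le> 1" if "s \<in> space L" for s
  proof -
    have "prob_space (K s)" using measurable_space[OF K that] by (simp add: space_prob_algebra)
    then show ?thesis unfolding k_def by (simp add: prob_space.prob_le_1)
  qed
  have 1: "AE w in P. k (V w) = cond_prob_given P L V (X -` E) w"
    using rcd E unfolding regular_cond_distr_def k_def by blast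
  have 2: "AE w in P. cond_prob_given P L V (X -` E \<inter> Y -` E') w =
        cond_prob_given P L V (X -` E) w * cond_prob_given P L V (Y -` E') w"
    using ci E E' unfolding cond_indep_var_def by blast
  have "measure P {w \<in> space P. X w \<in> E \<and> V w \<in> D \<and> Y w \<in> E'}
      = (\<integral>w. indicator D (V w) * indicator (X -` E \<inter> Y -` E' \<inter> space P) w \<partial>P)"
  proof -
    have "measure P {w \<in> space P. X w \<in> E \<and> V w \<in> D \<and> Y w \<in> E'}
        = (\<integral>w. indicator {w \<in> space P. X w \<in> E \<and> V w \<in> D \<and> Y w \<in> E'} w \<partial>P)"
      by simp
    also have "\<dots> = (\<integral>w. indicator D (V w) * indicator (X -` E \<inter> Y -` E' \<inter> space P) w \<partial>P)"
      by (intro Bochner_Integration.integral_cong) (auto split: split_indicator)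
    finally show ?thesis .
  qed
  also have "\<dots> = (\<integral>w. indicator D (V w) * cond_prob_given P L V (X -` E \<inter> Y -` E') w \<partial>P)"
    by (rule cond_prob_given_integral(2)[OF P V sets(1), symmetric]) (auto split: split_indicator)
  also have "\<dots> = (\<integral>w. (indicator D (V w) * k (V w)) * cond_prob_given P L V (Y -` E') w \<partial>P)"
  proof (rule integral_cong_AE)
    show "AE w in P. indicator D (V w) * cond_prob_given P L V (X -` E \<inter> Y -` E') w =
        (indicator D (V w) * k (V w)) * cond_prob_given P L V (Y -` E') w"
      using 1 2 by eventually_elim simp
    have [measurable]: "cond_prob_given P L V (X -` E \<inter> Y -` E') \<in> borel_measurable P"
      "cond_prob_given P L V (Y -` E') \<in> borel_measurable P"
      using cond_prob_given_integral(1)[OF P V _, of _ "\<lambda>_. 0"] sets by auto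
    show "(\<lambda>w. indicator D (V w) * cond_prob_given P L V (X -` E \<inter> Y -` E') w) \<in> borel_measurable P"
      "(\<lambda>w. (indicator D (V w) * k (V w)) * cond_prob_given P L V (Y -` E') w) \<in> borel_measurable P"
      by measurable
  qed
  also have "\<dots> = (\<integral>w. (indicator D (V w) * k (V w)) * indicator (Y -` E' \<inter> space P) w \<partial>P)"
    by (rule cond_prob_given_integral(2)[OF P V sets(2)]) (auto split: split_indicator intro: k1)
  also have "\<dots> = (\<integral>w. measure (K (V w)) E * indicator (D \<times> E') (V w, Y w) \<partial>P)"
    by (intro Bochner_Integration.integral_cong) (auto simp: k_def split: split_indicator)
  finally show ?thesis .
qed

text \<open>
  Conditional independence upgrades \<open>K\<close>: it stays the conditional distribution of \<open>X\<close> when the condition is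
  the pair \<open>(V, Y)\<close> instead of \<open>V\<close>.  It is stated for arbitrary measurable sets of the triple because
  the event that a p-value lies in a given set couples \<open>X\<close> with \<open>V\<close>.
\<close>

lemma joint_law_disintegration:
  assumes P: "prob_space P"
    and rcd: "regular_cond_distr P N X L V K"
    and ci: "cond_indep_var P N X N' Y L V"
    and G: "G \<in> sets (N \<Otimes>\<^sub>M (L \<Otimes>\<^sub>M N'))"
  shows "emeasure P {w \<in> space P. (X w, V w, Y w) \<in> G}
    = (\<integral>\<^sup>+w. emeasure (K (V w)) {x \<in> space N. (x, V w, Y w) \<in> G} \<partial>P)"
proof -
  interpret P: prob_space P by fact
  have X [measurable]: "X \<in> measurable P N" and V [measurable]: "V \<in> measurable P L"
    and Y [measurable]: "Y \<in> measurable P N'" and K [measurable]: "K \<in> measurable L (prob_algebra N)"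
    using rcd ci by (auto simp: regular_cond_distr_def cond_indep_var_def)
  have VY [measurable]: "(\<lambda>w. (V w, Y w)) \<in> measurable P (L \<Otimes>\<^sub>M N')" by measurable
  have Psp: "P \<in> space (prob_algebra P)" using P by (simp add: space_prob_algebra)
  have KV [measurable]: "(\<lambda>w. K (V w)) \<in> measurable P (prob_algebra N)" by measurable
  have KVsets: "sets (K (V w)) = sets N" "space (K (V w)) = space N" if "w \<in> space P" for w
    using measurable_space[OF KV that] by (auto simp: space_prob_algebra dest: sets_eq_imp_space_eq)
  have KVfin: "emeasure (K (V w)) A = ennreal (measure (K (V w)) A)" if "w \<in> space P" for w A
  proof -
    interpret prob_space "K (V w)"
      using measurable_space[OF KV that] by (auto simp: space_prob_algebra)
    show ?thesis by (rule emeasure_eq_measure)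
  qed
  \<comment> \<open>\<open>J1\<close> is the law of the triple and \<open>J2\<close> the law obtained by redrawing \<open>X\<close> from the kernel.\<close>
  define J1 where "J1 = distr P (N \<Otimes>\<^sub>M (L \<Otimes>\<^sub>M N')) (\<lambda>w. (X w, V w, Y w))"
  define k where "k w = distr (K (V w)) (N \<Otimes>\<^sub>M (L \<Otimes>\<^sub>M N')) (\<lambda>x. (x, V w, Y w))" for w
  have k [measurable]: "k \<in> measurable P (prob_algebra (N \<Otimes>\<^sub>M (L \<Otimes>\<^sub>M N')))"
    unfolding k_def by (rule measurable_distr_prob_space2[OF KV]) measurable
  define J2 where "J2 = bind P k"
  have J1_eq: "emeasure J1 B = emeasure P {w \<in> space P. (X w, V w, Y w) \<in> B}"
    if "B \<in> sets (N \<Otimes>\<^sub>M (L \<Otimes>\<^sub>M N'))" for B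
    unfolding J1_def using that by (subst emeasure_distr) (auto simp: vimage_def Int_def conj_commute)
  have J2_eq: "emeasure J2 B = (\<integral>\<^sup>+w. emeasure (K (V w)) {x \<in> space N. (x, V w, Y w) \<in> B} \<partial>P)"
    if "B \<in> sets (N \<Otimes>\<^sub>M (L \<Otimes>\<^sub>M N'))" for B
  proof -
    have "emeasure J2 B = (\<integral>\<^sup>+w. emeasure (k w) B \<partial>P)"
      unfolding J2_def by (rule emeasure_bind_prob_algebra[OF Psp k that])
    also have "\<dots> = (\<integral>\<^sup>+w. emeasure (K (V w)) {x \<in> space N. (x, V w, Y w) \<in> B} \<partial>P)"
    proof (rule nn_integral_cong)
      fix w assume w: "w \<in> space P"
      have "(\<lambda>x. (x, V w, Y w)) \<in> measurable (K (V w)) (N \<Otimes>\<^sub>M (L \<Otimes>\<^sub>M N'))"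
        unfolding measurable_cong_sets[OF KVsets(1)[OF w] refl]
        using measurable_space[OF VY w] by measurable
      then show "emeasure (k w) B = emeasure (K (V w)) {x \<in> space N. (x, V w, Y w) \<in> B}"
        unfolding k_def using that
        by (subst emeasure_distr) (auto simp: vimage_def Int_def conj_commute KVsets[OF w])
    qed
    finally show ?thesis .
  qed
  have "sets J2 = sets (N \<Otimes>\<^sub>M (L \<Otimes>\<^sub>M N'))" "prob_space J2"
    unfolding J2_def using sets_bind'[OF Psp k] prob_space_bind'[OF Psp k] by auto
  have "J1 = J2"
  proof (rule measure_eqI_rectangles)
    show sJ1: "sets J1 = sets (N \<Otimes>\<^sub>M (L \<Otimes>\<^sub>M N'))" by (simp add: J1_def)
    show "sets J2 = sets (N \<Otimes>\<^sub>M (L \<Otimes>\<^sub>M N'))" by fact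
    have "prob_space J1" unfolding J1_def by (rule P.prob_space_distr) measurable
    then show "finite_measure J1" by (simp add: prob_space_def)
    fix E C assume E [measurable]: "E \<in> sets N" and C: "C \<in> sets (L \<Otimes>\<^sub>M N')"
    \<comment> \<open>Fixing the \<open>X\<close>-side \<open>E\<close> leaves two finite measures on the remaining pair, which again are
      compared on rectangles.\<close>
    define slice where
      "slice J = distr (density J (indicator (E \<times> space (L \<Otimes>\<^sub>M N')))) (L \<Otimes>\<^sub>M N') snd" for J
    have slice: "emeasure (slice J) B = emeasure J (E \<times> B)"
      if J: "sets J = sets (N \<Otimes>\<^sub>M (L \<Otimes>\<^sub>M N'))" and B: "B \<in> sets (L \<Otimes>\<^sub>M N')" for J B
    proof -
      note J [measurable_cong] and B [measurable]
      have S: "E \<times> space (L \<Otimes>\<^sub>M N') \<in> sets J" "space N \<times> B \<in> sets J"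
        unfolding J by measurable
      have "snd -` B \<inter> space J = space N \<times> B"
        using sets.sets_into_space[OF B] sets_eq_imp_space_eq[OF J] by (auto simp: space_pair_measure)
      then have "emeasure (slice J) B
          = emeasure (density J (indicator (E \<times> space (L \<Otimes>\<^sub>M N')))) (space N \<times> B)"
        unfolding slice_def by (subst emeasure_distr) auto
      also have "\<dots> = emeasure J ((E \<times> space (L \<Otimes>\<^sub>M N')) \<inter> (space N \<times> B))"
        by (rule emeasure_restricted[OF S])
      also have "(E \<times> space (L \<Otimes>\<^sub>M N')) \<inter> (space N \<times> B) = E \<times> B"
        using sets.sets_into_space[OF B] sets.sets_into_space[OF E] by auto
      finally show ?thesis .
    qed
    have "slice J1 = slice J2"
    proof (rule measure_eqI_rectangles)
      show "sets (slice J1) = sets (L \<Otimes>\<^sub>M N')" "sets (slice J2) = sets (L \<Otimes>\<^sub>M N')"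
        by (simp_all add: slice_def)
      have "emeasure (slice J1) (space (slice J1)) \<le> 1"
        using prob_space.measure_le_1[OF \<open>prob_space J1\<close>] slice[OF sJ1 sets.top] by (simp add: slice_def)
      then show "finite_measure (slice J1)"
        by (intro finite_measureI) (auto simp: top_unique)
      fix D E' assume D [measurable]: "D \<in> sets L" and E' [measurable]: "E' \<in> sets N'"
      have DE: "D \<times> E' \<in> sets (L \<Otimes>\<^sub>M N')" by measurable
      have 1: "emeasure J1 (E \<times> D \<times> E') = ennreal (measure P {w \<in> space P. X w \<in> E \<and> V w \<in> D \<and> Y w \<in> E'})"
        by (subst J1_eq) (auto simp: P.emeasure_eq_measure)
      have sl: "emeasure (K (V w)) {x \<in> space N. (x, V w, Y w) \<in> E \<times> D \<times> E'}
          = ennreal (measure (K (V w)) E * indicator (D \<times> E') (V w, Y w))" if w: "w \<in> space P" for w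
      proof -
        have "{x \<in> space N. (x, V w, Y w) \<in> E \<times> D \<times> E'} = (if V w \<in> D \<and> Y w \<in> E' then E else {})"
          using sets.sets_into_space[OF E] by auto
        then show ?thesis by (simp add: KVfin[OF w] split: split_indicator)
      qed
      have m [measurable]: "(\<lambda>w. measure (K (V w)) E) \<in> borel_measurable P"
        using measurable_compose[OF KV measurable_measure_prob_algebra[OF E]] .
      have le1: "measure (K (V w)) E \<le> 1" if "w \<in> space P" for w
        using measurable_space[OF KV that] by (auto simp: space_prob_algebra prob_space.prob_le_1)
      have "emeasure J2 (E \<times> D \<times> E') = (\<integral>\<^sup>+w. ennreal (measure (K (V w)) E * indicator (D \<times> E') (V w, Y w)) \<partial>P)"
        by (subst J2_eq) (simp_all only: sl cong: nn_integral_cong, measurable)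
      also have "\<dots> = ennreal (\<integral>w. measure (K (V w)) E * indicator (D \<times> E') (V w, Y w) \<partial>P)"
        by (intro nn_integral_eq_integral P.integrable_const_bound[where B=1])
           (auto intro: le1 split: split_indicator)
      also have "\<dots> = emeasure J1 (E \<times> D \<times> E')"
        unfolding 1 kernel_measure_eq_joint_prob[OF P rcd ci E D E'] ..
      finally show "emeasure (slice J1) (D \<times> E') = emeasure (slice J2) (D \<times> E')"
        using slice[OF sJ1 DE] slice[OF \<open>sets J2 = _\<close> DE] by simp
    qed
    then show "emeasure J1 (E \<times> C) = emeasure J2 (E \<times> C)"
      using slice[OF sJ1 C] slice[OF \<open>sets J2 = _\<close> C] by simp
  qed
  then show ?thesis using J1_eq[OF G] J2_eq[OF G] by simp
qed

section \<open>Uniformity given the later data\<close>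

text \<open>
  The step that makes one p-value independent of all later data.  Given \<open>(V, Y)\<close>, the first observations
  have distribution \<open>K (V z)\<close>, which is also the reference distribution of the p-value, so the randomized
  integral transform applies inside the integral over \<open>(V, Y)\<close> and \<open>R\<close>.  The reference distribution remains
  \<open>K (V z)\<close> while \<open>X\<close> is redrawn.
\<close>

lemma smoothed_p_value_uniform_given_later:
  assumes P: "prob_space P" and R: "prob_space R"
    and rcd: "regular_cond_distr P N X L V K"
    and ci: "cond_indep_var P N X N' Y L V"
    and f [measurable]: "f \<in> borel_measurable N"
    and B: "B \<in> sets borel" and C: "C \<in> sets ((L \<Otimes>\<^sub>M N') \<Otimes>\<^sub>M R)"
  defines "\<Omega> \<equiv> P \<Otimes>\<^sub>M (unif \<Otimes>\<^sub>M R)"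
  shows "emeasure \<Omega> {w \<in> space \<Omega>.
        smoothed_p_value (K (V (fst w))) f (f (X (fst w))) (fst (snd w)) \<in> B
        \<and> ((V (fst w), Y (fst w)), snd (snd w)) \<in> C}
    = emeasure unif B * emeasure \<Omega> {w \<in> space \<Omega>. ((V (fst w), Y (fst w)), snd (snd w)) \<in> C}"
proof -
  interpret P: prob_space P by fact
  interpret U: prob_space unif by (rule prob_space_unif)
  interpret R: prob_space R by fact
  interpret UR: pair_prob_space unif R ..
  interpret PU: pair_prob_space P unif ..
  interpret PUR: pair_prob_space P "unif \<Otimes>\<^sub>M R" ..
  have X [measurable]: "X \<in> measurable P N" and V [measurable]: "V \<in> measurable P L"
    and Y [measurable]: "Y \<in> measurable P N'" and K [measurable]: "K \<in> measurable L (prob_algebra N)"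
    using rcd ci by (auto simp: regular_cond_distr_def cond_indep_var_def)
  have KV [measurable]: "(\<lambda>z. K (V z)) \<in> measurable P (prob_algebra N)" by measurable
  note C [measurable]
  \<comment> \<open>Once \<open>X\<close> and the random number are integrated out, only this factor depends on \<open>C\<close>.\<close>
  define c where "c = (\<integral>\<^sup>+r. \<integral>\<^sup>+z. indicator C ((V z, Y z), r) \<partial>P \<partial>R)"
  have main: "emeasure \<Omega> {w \<in> space \<Omega>.
        smoothed_p_value (K (V (fst w))) f (f (X (fst w))) (fst (snd w)) \<in> B
        \<and> ((V (fst w), Y (fst w)), snd (snd w)) \<in> C} = emeasure unif B * c"
    if B [measurable]: "B \<in> sets borel" for B
  proof -
    let ?g = "\<lambda>v s x. smoothed_p_value (K v) f (f x) s"
    define h where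
      "h z s r = emeasure (K (V z)) {x \<in> space N. ?g (V z) s x \<in> B \<and> ((V z, Y z), r) \<in> C}" for z s r
    have h [measurable]: "(\<lambda>(z, s, r). h z s r) \<in> borel_measurable (P \<Otimes>\<^sub>M (unif \<Otimes>\<^sub>M R))"
    proof -
      have [measurable]: "(\<lambda>w. ?g (V (fst (fst w))) (fst (snd (fst w))) (snd w))
          \<in> borel_measurable ((P \<Otimes>\<^sub>M (unif \<Otimes>\<^sub>M R)) \<Otimes>\<^sub>M N)"
        by (rule measurable_smoothed_p_value[OF K f]) measurable
      have "(\<lambda>w. emeasure (K (V (fst w)))
          {x \<in> space N. ?g (V (fst w)) (fst (snd w)) x \<in> B \<and> ((V (fst w), Y (fst w)), snd (snd w)) \<in> C})
          \<in> borel_measurable (P \<Otimes>\<^sub>M (unif \<Otimes>\<^sub>M R))" (is "(\<lambda>w. emeasure (K (V (fst w))) (?A w)) \<in> _")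
      proof (rule emeasure_measurable_subprob_algebra2)
        have "Sigma (space (P \<Otimes>\<^sub>M (unif \<Otimes>\<^sub>M R))) ?A
            = {w \<in> space ((P \<Otimes>\<^sub>M (unif \<Otimes>\<^sub>M R)) \<Otimes>\<^sub>M N).
                ?g (V (fst (fst w))) (fst (snd (fst w))) (snd w) \<in> B
                \<and> ((V (fst (fst w)), Y (fst (fst w))), snd (snd (fst w))) \<in> C}"
          by (auto simp: space_pair_measure)
        also have "\<dots> \<in> sets ((P \<Otimes>\<^sub>M (unif \<Otimes>\<^sub>M R)) \<Otimes>\<^sub>M N)"
          by measurable
        finally show "Sigma (space (P \<Otimes>\<^sub>M (unif \<Otimes>\<^sub>M R))) ?A \<in> sets ((P \<Otimes>\<^sub>M (unif \<Otimes>\<^sub>M R)) \<Otimes>\<^sub>M N)" .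
        show "(\<lambda>w. K (V (fst w))) \<in> measurable (P \<Otimes>\<^sub>M (unif \<Otimes>\<^sub>M R)) (subprob_algebra N)"
          by (rule measurable_prob_algebraD) measurable
      qed
      then show ?thesis unfolding h_def by (simp add: case_prod_beta')
    qed
    have [measurable]: "(\<lambda>w. ?g (V (fst w)) (fst (snd w)) (X (fst w))) \<in> borel_measurable (P \<Otimes>\<^sub>M (unif \<Otimes>\<^sub>M R))"
      by (rule measurable_smoothed_p_value[OF K f]) measurable
    let ?E = "{w \<in> space \<Omega>. ?g (V (fst w)) (fst (snd w)) (X (fst w)) \<in> B
        \<and> ((V (fst w), Y (fst w)), snd (snd w)) \<in> C}"
    have ev: "?E \<in> sets \<Omega>"
      unfolding \<Omega>_def by measurable
    have slice: "emeasure P ((\<lambda>z. (z, y)) -` ?E)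
        = (\<integral>\<^sup>+z. h z (fst y) (snd y) \<partial>P)" if y: "y \<in> space (unif \<Otimes>\<^sub>M R)" for y
    proof -
      have r [measurable]: "snd y \<in> space R" using y by (auto simp: space_pair_measure)
      let ?G = "{x \<in> space (N \<Otimes>\<^sub>M (L \<Otimes>\<^sub>M N')). ?g (fst (snd x)) (fst y) (fst x) \<in> B \<and> (snd x, snd y) \<in> C}"
      have [measurable]: "(\<lambda>x. ?g (fst (snd x)) (fst y) (fst x)) \<in> borel_measurable (N \<Otimes>\<^sub>M (L \<Otimes>\<^sub>M N'))"
        by (rule measurable_smoothed_p_value[OF K f]) measurable
      have G: "?G \<in> sets (N \<Otimes>\<^sub>M (L \<Otimes>\<^sub>M N'))" by measurable
      have "(\<lambda>z. (z, y)) -` ?E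
          = {z \<in> space P. (X z, V z, Y z) \<in> ?G}"
        using y measurable_space[OF X] measurable_space[OF V] measurable_space[OF Y]
        by (auto simp: \<Omega>_def space_pair_measure)
      then have "emeasure P ((\<lambda>z. (z, y)) -` ?E)
          = (\<integral>\<^sup>+z. emeasure (K (V z)) {x \<in> space N. (x, V z, Y z) \<in> ?G} \<partial>P)"
        using joint_law_disintegration[OF P rcd ci G] by simp
      also have "\<dots> = (\<integral>\<^sup>+z. h z (fst y) (snd y) \<partial>P)"
        unfolding h_def using measurable_space[OF V] measurable_space[OF Y]
        by (intro nn_integral_cong arg_cong2[where f=emeasure]) (auto simp: space_pair_measure)
      finally show ?thesis .
    qed
    have uniform: "(\<integral>\<^sup>+s. h z s r \<partial>unif) = emeasure unif B * indicator C ((V z, Y z), r)"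
      if z: "z \<in> space P" and r: "r \<in> space R" for z r
    proof -
      let ?Q = "K (V z)"
      have Q: "prob_space ?Q" and sQ [measurable_cong]: "sets ?Q = sets N"
        using measurable_space[OF KV z] by (auto simp: space_prob_algebra)
      interpret Q: prob_space ?Q by fact
      interpret QU: pair_prob_space ?Q unif ..
      have spQ: "space ?Q = space N" using sQ by (rule sets_eq_imp_space_eq)
      have fQ: "f \<in> borel_measurable ?Q" by measurable
      have gm [measurable]: "(\<lambda>w. ?g (V z) (snd w) (fst w)) \<in> borel_measurable (?Q \<Otimes>\<^sub>M unif)"
        using measurable_space[OF V z] by (intro measurable_smoothed_p_value[OF K f]) measurable
      have "emeasure unif B = emeasure (distr (?Q \<Otimes>\<^sub>M unif) unif (\<lambda>w. ?g (V z) (snd w) (fst w))) B"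
        using Q.distr_smoothed_p_value[OF fQ] by simp
      also have "\<dots> = emeasure (?Q \<Otimes>\<^sub>M unif) {w \<in> space (?Q \<Otimes>\<^sub>M unif). ?g (V z) (snd w) (fst w) \<in> B}"
        by (subst emeasure_distr) (auto simp: vimage_def Int_def conj_commute)
      also have "\<dots> = (\<integral>\<^sup>+s. emeasure ?Q ((\<lambda>x. (x, s)) -` {w \<in> space (?Q \<Otimes>\<^sub>M unif). ?g (V z) (snd w) (fst w) \<in> B}) \<partial>unif)"
        by (rule QU.emeasure_pair_measure_alt2) measurable
      also have "\<dots> = (\<integral>\<^sup>+s. emeasure ?Q {x \<in> space N. ?g (V z) s x \<in> B} \<partial>unif)"
        by (intro nn_integral_cong arg_cong2[where f=emeasure]) (auto simp: space_pair_measure spQ)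
      finally show ?thesis
        by (cases "((V z, Y z), r) \<in> C") (simp_all add: h_def)
    qed
    have "emeasure \<Omega> ?E
        = (\<integral>\<^sup>+y. \<integral>\<^sup>+z. h z (fst y) (snd y) \<partial>P \<partial>(unif \<Otimes>\<^sub>M R))"
      using PUR.emeasure_pair_measure_alt2[OF ev[unfolded \<Omega>_def]]
      unfolding \<Omega>_def[symmetric] by (rule trans) (intro nn_integral_cong slice)
    also have "\<dots> = (\<integral>\<^sup>+r. \<integral>\<^sup>+s. \<integral>\<^sup>+z. h z s r \<partial>P \<partial>unif \<partial>R)"
    proof -
      have "(\<lambda>(s, r). \<integral>\<^sup>+z. h z s r \<partial>P) \<in> borel_measurable (unif \<Otimes>\<^sub>M R)"
        unfolding case_prod_beta'
      proof (rule P.borel_measurable_nn_integral)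
        show "(\<lambda>(x, z). h z (fst x) (snd x)) \<in> borel_measurable ((unif \<Otimes>\<^sub>M R) \<Otimes>\<^sub>M P)"
          using measurable_compose[OF measurable_Pair[OF measurable_snd measurable_fst] h]
          by (simp add: case_prod_beta')
      qed
      from UR.nn_integral_snd[OF this] show ?thesis by (simp add: case_prod_beta')
    qed
    also have "\<dots> = (\<integral>\<^sup>+r. \<integral>\<^sup>+z. \<integral>\<^sup>+s. h z s r \<partial>unif \<partial>P \<partial>R)"
    proof (rule nn_integral_cong)
      fix r assume r: "r \<in> space R"
      show "(\<integral>\<^sup>+s. \<integral>\<^sup>+z. h z s r \<partial>P \<partial>unif) = (\<integral>\<^sup>+z. \<integral>\<^sup>+s. h z s r \<partial>unif \<partial>P)"
      proof (rule PU.Fubini')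
        have "(\<lambda>x. (fst x, snd x, r)) \<in> measurable (P \<Otimes>\<^sub>M unif) (P \<Otimes>\<^sub>M (unif \<Otimes>\<^sub>M R))"
          using r by (intro measurable_Pair measurable_fst measurable_snd measurable_const)
        from measurable_compose[OF this h]
        show "(\<lambda>(z, s). h z s r) \<in> borel_measurable (P \<Otimes>\<^sub>M unif)"
          by (simp add: case_prod_beta')
      qed
    qed
    also have "\<dots> = (\<integral>\<^sup>+r. \<integral>\<^sup>+z. emeasure unif B * indicator C ((V z, Y z), r) \<partial>P \<partial>R)"
      by (intro nn_integral_cong uniform)
    also have "\<dots> = emeasure unif B * c"
      unfolding c_def by (subst nn_integral_cmult[symmetric]; (intro nn_integral_cong nn_integral_cmult)?; measurable)
    finally show ?thesis .
  qed
  \<comment> \<open>With no constraint on the p-value the factor \<open>c\<close> is the probability of \<open>C\<close>.\<close>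
  from main[of UNIV] have "emeasure \<Omega> {w \<in> space \<Omega>. ((V (fst w), Y (fst w)), snd (snd w)) \<in> C} = c"
    using U.emeasure_space_1 by simp
  with main[OF B] show ?thesis by simp
qed

section \<open>Conformal p-values\<close>

text \<open>
  The situation of the theorem for a single distribution \<open>P\<close> of the model, with the updating functions
  \<open>F\<close> of algebraic transitivity chosen once and for all.
\<close>

locale conformal_prediction =
  fixes Z :: "'a measure" and T :: "nat \<Rightarrow> 's measure"
    and S :: "nat \<Rightarrow> (nat \<Rightarrow> 'a) \<Rightarrow> 's" and F :: "nat \<Rightarrow> 's \<times> 'a \<Rightarrow> 's"
    and K :: "nat \<Rightarrow> 's \<Rightarrow> (nat \<Rightarrow> 'a) measure" and A :: "nat \<Rightarrow> 's \<times> 'a \<Rightarrow> real"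
    and P :: "(nat \<Rightarrow> 'a) measure"
  assumes S [measurable]: "\<And>n. S n \<in> measurable (Zfin Z n) (T n)"
    and F: "\<And>n. n \<ge> 2 \<Longrightarrow> F n \<in> measurable (T (n - 1) \<Otimes>\<^sub>M Z) (T n)"
    and S_eq_F: "\<And>n z. n \<ge> 2 \<Longrightarrow> z \<in> space (Zfin Z n) \<Longrightarrow> S n z = F n (S (n - 1) (first_obs (n - 1) z), z n)"
    and A: "\<And>n. n \<ge> 1 \<Longrightarrow> A n \<in> borel_measurable (T (n - 1) \<Otimes>\<^sub>M Z)"
    and K_cond_distr: "\<And>n. n \<ge> 1 \<Longrightarrow>
      regular_cond_distr P (Zfin Z n) (first_obs n) (T n) (\<lambda>z. S n (first_obs n z)) (K n)"
    and cond_indep: "\<And>n. n \<ge> 1 \<Longrightarrow>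
      cond_indep_var P (Zfin Z n) (first_obs n) (\<Pi>\<^sub>M i\<in>{n<..}. Z) (later_obs n) (T n) (\<lambda>z. S n (first_obs n z))"
    and prob_space_P: "prob_space P" and sets_P: "sets P = sets (Zinf Z)"
begin

lemma K [measurable]: "n \<ge> 1 \<Longrightarrow> K n \<in> measurable (T n) (prob_algebra (Zfin Z n))"
  using K_cond_distr by (simp add: regular_cond_distr_def)

lemma measurable_first_obs [measurable]:
  "first_obs n \<in> measurable (Zinf Z) (Zfin Z n)" "k \<le> n \<Longrightarrow> first_obs k \<in> measurable (Zfin Z n) (Zfin Z k)"
  unfolding first_obs_def Zinf_def Zfin_def by (auto intro!: measurable_restrict_subset)

lemma measurable_later_obs [measurable]:
  "later_obs n \<in> measurable (Zinf Z) (\<Pi>\<^sub>M i\<in>{n<..}. Z)"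
  unfolding later_obs_def Zinf_def by (auto intro!: measurable_restrict_subset)

lemma first_obs_first_obs: "k \<le> n \<Longrightarrow> first_obs k (first_obs n z) = first_obs k z"
  by (auto simp: first_obs_def fun_eq_iff)

lemma score_measurable: "n \<ge> 1 \<Longrightarrow> nonconformity_score S A n \<in> borel_measurable (Zfin Z n)"
proof -
  assume n: "n \<ge> 1"
  have "(\<lambda>z. z n) \<in> measurable (Zfin Z n) Z"
    unfolding Zfin_def using n by (intro measurable_component_singleton) auto
  moreover have "(\<lambda>z. S (n - 1) (first_obs (n - 1) z)) \<in> measurable (Zfin Z n) (T (n - 1))"
    by (rule measurable_compose[OF measurable_first_obs(2) S]) simp
  ultimately have "(\<lambda>z. A n (S (n - 1) (first_obs (n - 1) z), z n)) \<in> borel_measurable (Zfin Z n)"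
    by (intro measurable_compose[OF _ A[OF n]] measurable_Pair)
  then show ?thesis by (simp add: nonconformity_score_def[abs_def])
qed

lemma p_value_eq_smoothed:
  assumes n: "n \<ge> 1" and z: "z \<in> space (Zinf Z)"
  shows "p_value Z S K A n z t = smoothed_p_value (K n (S n (first_obs n z)))
    (nonconformity_score S A n) (nonconformity_score S A n (first_obs n z)) t"
proof -
  have "K n (S n (first_obs n z)) \<in> space (prob_algebra (Zfin Z n))"
    by (intro measurable_space[OF K[OF n]] measurable_space[OF S] measurable_space[OF measurable_first_obs(1)] z)
  then have "space (K n (S n (first_obs n z))) = space (Zfin Z n)"
    by (auto simp: space_prob_algebra dest: sets_eq_imp_space_eq)
  moreover have "nonconformity_score S A n (first_obs n z) = nonconformity_score S A n z"
    using n by (simp add: nonconformity_score_def first_obs_first_obs) (simp add: first_obs_def)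
  ultimately show ?thesis by (simp add: p_value_def smoothed_p_value_def Let_def)
qed

lemma measurable_p_value:
  assumes n: "n \<ge> 1"
  shows "(\<lambda>(z, t). p_value Z S K A n z t) \<in> borel_measurable (Zinf Z \<Otimes>\<^sub>M borel)"
proof -
  have first: "(\<lambda>x. first_obs n (fst x)) \<in> measurable (Zinf Z \<Otimes>\<^sub>M borel) (Zfin Z n)"
    by (rule measurable_compose[OF measurable_fst measurable_first_obs(1)])
  have "(\<lambda>x. smoothed_p_value (K n (S n (first_obs n (fst x)))) (nonconformity_score S A n)
      (nonconformity_score S A n (first_obs n (fst x))) (snd x)) \<in> borel_measurable (Zinf Z \<Otimes>\<^sub>M borel)"
    by (rule measurable_smoothed_p_value[OF K[OF n] score_measurable[OF n]
          measurable_compose[OF first S] measurable_compose[OF first score_measurable[OF n]] measurable_snd])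
  then show ?thesis
    by (rule measurable_cong[THEN iffD1, rotated]) (auto simp: p_value_eq_smoothed[OF n] space_pair_measure)
qed

text \<open>
  The space and the value of what is known in reverse time after step \<open>m\<close>: the statistic of the first \<open>m\<close>
  observations, together with the later observations and the later random numbers.
\<close>

definition later_space :: "nat \<Rightarrow> (('s \<times> (nat \<Rightarrow> 'a)) \<times> (nat \<Rightarrow> real)) measure" where
  "later_space m = (T m \<Otimes>\<^sub>M (\<Pi>\<^sub>M i\<in>{m<..}. Z)) \<Otimes>\<^sub>M (\<Pi>\<^sub>M i\<in>{m<..}. unif)"

definition later_data :: "nat \<Rightarrow> (nat \<Rightarrow> 'a) \<Rightarrow> (nat \<Rightarrow> real) \<Rightarrow> ('s \<times> (nat \<Rightarrow> 'a)) \<times> (nat \<Rightarrow> real)" where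
  "later_data m z t = ((S m (first_obs m z), later_obs m z), restrict t {m<..})"

lemma later_data_in_space: "z \<in> space (Zinf Z) \<Longrightarrow> later_data m z t \<in> space (later_space m)"
  using measurable_space[OF measurable_compose[OF measurable_first_obs(1) S]]
    measurable_space[OF measurable_later_obs]
  by (auto simp: later_data_def later_space_def space_pair_measure space_PiM)

lemma S_Suc:
  assumes m: "m \<ge> 1" and z: "z \<in> space (Zinf Z)"
  shows "S (Suc m) (first_obs (Suc m) z) = F (Suc m) (S m (first_obs m z), z (Suc m))"
  using S_eq_F[of "Suc m" "first_obs (Suc m) z"] m measurable_space[OF measurable_first_obs(1) z]
  by (simp add: first_obs_first_obs) (simp add: first_obs_def)

text \<open>
  Here algebraic transitivity enters: \<open>S m\<close> and the later observations give \<open>S (m + 1)\<close> by one application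
  of \<open>F\<close>, hence all later statistics, and the p-value at \<open>m + 1\<close> depends only on \<open>S m\<close>, \<open>S (m + 1)\<close>, the
  observation and the random number at \<open>m + 1\<close>.
\<close>

lemma later_p_values_determined:
  assumes "m \<ge> 1" and "\<And>i. B i \<in> sets borel"
  shows "\<exists>C \<in> sets (later_space m). \<forall>z \<in> space (Zinf Z). \<forall>t.
    (\<forall>i\<in>{m<..m + k}. p_value Z S K A i z (t i) \<in> B i) \<longleftrightarrow> later_data m z t \<in> C"
  using assms(1)
proof (induction k arbitrary: m)
  case 0
  then show ?case
    by (intro bexI[of _ "space (later_space m)"]) (auto simp: later_data_in_space)
next
  case (Suc k)
  let ?n = "Suc m"
  obtain C where C: "C \<in> sets (later_space ?n)"
    "\<And>z t. z \<in> space (Zinf Z) \<Longrightarrow>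
      (\<forall>i\<in>{?n<..?n + k}. p_value Z S K A i z (t i) \<in> B i) \<longleftrightarrow> later_data ?n z t \<in> C"
    using Suc.IH[of ?n] by auto
  note B = assms(2)[of ?n]
  have F': "F ?n \<in> measurable (T m \<Otimes>\<^sub>M Z) (T ?n)" and A': "A ?n \<in> borel_measurable (T m \<Otimes>\<^sub>M Z)"
    using F[of ?n] A[of ?n] Suc.prems by simp_all
  \<comment> \<open>\<open>next_obs\<close> is the argument shared by \<open>F\<close> and \<open>A\<close>, \<open>G\<close> passes from the data after \<open>m\<close> to
    the data after \<open>m + 1\<close>, and \<open>q\<close> reads off the p-value in between.\<close>
  define next_obs where "next_obs = (\<lambda>x :: ('s \<times> (nat \<Rightarrow> 'a)) \<times> (nat \<Rightarrow> real). (fst (fst x), snd (fst x) ?n))"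
  define G where "G x = ((F ?n (next_obs x), restrict (snd (fst x)) {?n<..}), restrict (snd x) {?n<..})" for x
  define q where "q x = smoothed_p_value (K ?n (F ?n (next_obs x))) (nonconformity_score S A ?n)
    (A ?n (next_obs x)) (snd x ?n)" for x
  have comp: "(\<lambda>x. snd (fst x) ?n) \<in> measurable (later_space m) Z"
    unfolding later_space_def
    by (rule measurable_compose[OF measurable_compose[OF measurable_fst measurable_snd]
          measurable_component_singleton]) simp
  have comp': "(\<lambda>x. snd x ?n) \<in> borel_measurable (later_space m)"
    unfolding later_space_def
    by (rule measurable_compose[OF measurable_snd]) (use measurable_component_singleton[of ?n "{m<..}" "\<lambda>_. unif"] in simp)
  have next_obs: "next_obs \<in> measurable (later_space m) (T m \<Otimes>\<^sub>M Z)"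
    unfolding next_obs_def by (rule measurable_Pair[OF _ comp]) (simp add: later_space_def)
  have Fn: "(\<lambda>x. F ?n (next_obs x)) \<in> measurable (later_space m) (T ?n)"
    by (rule measurable_compose[OF next_obs F'])
  have G: "G \<in> measurable (later_space m) (later_space ?n)"
  proof -
    have "(\<lambda>x. restrict (snd (fst x)) {?n<..}) \<in> measurable (later_space m) (\<Pi>\<^sub>M i\<in>{?n<..}. Z)"
      "(\<lambda>x. restrict (snd x) {?n<..}) \<in> measurable (later_space m) (\<Pi>\<^sub>M i\<in>{?n<..}. unif)"
      unfolding later_space_def
      by (rule measurable_compose[OF _ measurable_restrict_subset[of _ "{m<..}"]]; auto)+
    then show ?thesis
      unfolding G_def[abs_def] later_space_def[of ?n] by (intro measurable_Pair Fn)
  qed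
  have q: "q \<in> borel_measurable (later_space m)"
    unfolding q_def[abs_def]
    by (rule measurable_smoothed_p_value[OF K score_measurable Fn measurable_compose[OF next_obs A'] comp']) simp_all
  have nx: "next_obs (later_data m z t) = (S m (first_obs m z), z ?n)" for z t
    by (simp add: next_obs_def later_data_def later_obs_def)
  have G_later: "G (later_data m z t) = later_data ?n z t" if "z \<in> space (Zinf Z)" for z t
    unfolding G_def nx S_Suc[OF Suc.prems that, symmetric]
    by (auto simp: later_data_def later_obs_def fun_eq_iff)
  have q_later: "q (later_data m z t) = p_value Z S K A ?n z (t ?n)" if "z \<in> space (Zinf Z)" for z t
  proof -
    have "nonconformity_score S A ?n (first_obs ?n z) = A ?n (S m (first_obs m z), z ?n)"
      by (simp add: nonconformity_score_def first_obs_first_obs) (simp add: first_obs_def)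
    then show ?thesis
      unfolding q_def nx S_Suc[OF Suc.prems that, symmetric]
      by (simp add: p_value_eq_smoothed[OF _ that]) (simp add: later_data_def)
  qed
  have iv: "{m<..m + Suc k} = insert ?n {?n<..?n + k}" by auto
  show ?case
  proof (intro bexI[of _ "(q -` B ?n \<inter> space (later_space m)) \<inter> (G -` C \<inter> space (later_space m))"] ballI allI)
    show "(q -` B ?n \<inter> space (later_space m)) \<inter> (G -` C \<inter> space (later_space m)) \<in> sets (later_space m)"
      by (intro sets.Int measurable_sets[OF q B] measurable_sets[OF G C(1)])
    fix z t assume z: "z \<in> space (Zinf Z)"
    show "(\<forall>i\<in>{m<..m + Suc k}. p_value Z S K A i z (t i) \<in> B i) \<longleftrightarrow>
        later_data m z t \<in> (q -` B ?n \<inter> space (later_space m)) \<inter> (G -` C \<inter> space (later_space m))"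
      unfolding iv using C(2)[OF z, of t] later_data_in_space[OF z, of m t]
      by (simp add: G_later[OF z] q_later[OF z])
  qed
qed

text \<open>
  The p-values in a window are peeled off from the earliest one: each is uniform and independent of the
  event that the later ones fix, since that event is one about the later data.
\<close>

theorem p_values_iid_uniform:
  assumes M: "prob_space M"
    and \<zeta>: "\<zeta> \<in> measurable M (Zinf Z)" "distr M (Zinf Z) \<zeta> = P"
    and \<tau>: "\<tau> \<in> measurable M unif_inf" "distr M unif_inf \<tau> = unif_inf"
    and ind: "indep_elements M (Zinf Z) \<zeta> unif_inf \<tau>"
  shows "distr M unif_inf (\<lambda>w. \<lambda>n\<in>{1..}. p_value Z S K A n (\<zeta> w) (\<tau> w n)) = unif_inf"
proof -
  interpret M: prob_space M by fact
  define p where "p n w = p_value Z S K A n (\<zeta> w) (\<tau> w n)" for n w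
  have \<tau>n: "(\<lambda>w. \<tau> w n) \<in> borel_measurable M" if "n \<ge> 1" for n
    using measurable_compose[OF \<tau>(1)[unfolded unif_inf_def] measurable_component_singleton[of n]] that
    unfolding measurable_cong_sets[OF refl sets_unif] by simp
  have p_meas: "p n \<in> borel_measurable M" if "n \<ge> 1" for n
    using measurable_compose[OF measurable_Pair[OF \<zeta>(1) \<tau>n[OF that]] measurable_p_value[OF that]]
    by (simp add: p_def[abs_def])
  have \<zeta>_space: "\<zeta> w \<in> space (Zinf Z)" if "w \<in> space M" for w
    by (rule measurable_space[OF \<zeta>(1) that])

  \<comment> \<open>The law of the observations, the random number at \<open>n\<close> and the later random numbers is a
    product, so the uniformity given the later data carries over to \<open>M\<close>.\<close>
  have peel: "emeasure M {w \<in> space M. p n w \<in> B \<and> later_data n (\<zeta> w) (\<tau> w) \<in> C}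
      = emeasure unif B * emeasure M {w \<in> space M. later_data n (\<zeta> w) (\<tau> w) \<in> C}"
    if n: "n \<ge> 1" and B [measurable]: "B \<in> sets borel" and C: "C \<in> sets (later_space n)" for n B C
  proof -
    let ?U = "\<Pi>\<^sub>M i\<in>{n<..}. unif"
    let ?\<Omega> = "P \<Otimes>\<^sub>M (unif \<Otimes>\<^sub>M ?U)" and ?\<Omega>' = "Zinf Z \<Otimes>\<^sub>M (unif \<Otimes>\<^sub>M ?U)"
    let ?s = "\<lambda>t. (t n, restrict t {n<..})"
    let ?\<phi> = "\<lambda>w. (\<zeta> w, ?s (\<tau> w))"
    have split: "?s \<in> measurable unif_inf (unif \<Otimes>\<^sub>M ?U)"
      unfolding unif_inf_def using n
      by (intro measurable_Pair measurable_component_singleton measurable_restrict_subset) auto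
    have id_split: "(\<lambda>(z, t). (z, ?s t)) \<in> measurable (Zinf Z \<Otimes>\<^sub>M unif_inf) ?\<Omega>'"
      unfolding case_prod_beta' by (intro measurable_Pair measurable_fst measurable_compose[OF measurable_snd split])
    have \<phi>: "?\<phi> \<in> measurable M ?\<Omega>'"
      by (intro measurable_Pair \<zeta> measurable_compose[OF \<tau>(1) split])
    have U: "prob_space ?U" by (intro prob_space_PiM prob_space_unif)
    interpret UU: prob_space "unif \<Otimes>\<^sub>M ?U" by (intro prob_space_pair prob_space_unif U)
    have splitU: "distr unif_inf (unif \<Otimes>\<^sub>M ?U) ?s = unif \<Otimes>\<^sub>M ?U"
      unfolding unif_inf_def using n by (intro distr_PiM_split_component prob_space_unif) auto
    have "distr M ?\<Omega>' ?\<phi>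
        = distr (distr M (Zinf Z \<Otimes>\<^sub>M unif_inf) (\<lambda>w. (\<zeta> w, \<tau> w))) ?\<Omega>' (\<lambda>(z, t). (z, ?s t))"
      by (subst distr_distr[OF id_split measurable_Pair[OF \<zeta>(1) \<tau>(1)]]) (simp add: comp_def)
    also have "\<dots> = distr (P \<Otimes>\<^sub>M unif_inf) ?\<Omega>' (\<lambda>(z, t). (z, ?s t))"
      by (simp add: distr_indep_elements[OF M ind] \<zeta> \<tau>)
    also have "\<dots> = distr P (Zinf Z) (\<lambda>z. z) \<Otimes>\<^sub>M distr unif_inf (unif \<Otimes>\<^sub>M ?U) ?s"
      by (rule pair_measure_distr[symmetric])
         (auto simp: splitU split UU.sigma_finite_measure_axioms measurable_ident_sets sets_P)
    also have "\<dots> = ?\<Omega>"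
      unfolding splitU using distr_id2[OF sets_P[symmetric]] by simp
    finally have law: "distr M ?\<Omega>' ?\<phi> = ?\<Omega>" .
    have sets\<Omega>: "sets ?\<Omega> = sets ?\<Omega>'" by (intro sets_pair_measure_cong sets_P refl)
    have emeasure_law: "emeasure ?\<Omega> {x \<in> space ?\<Omega>. Q x} = emeasure M {w \<in> space M. Q (?\<phi> w)}"
      if "{x \<in> space ?\<Omega>. Q x} \<in> sets ?\<Omega>" for Q
    proof -
      have "emeasure ?\<Omega> {x \<in> space ?\<Omega>. Q x} = emeasure M (?\<phi> -` {x \<in> space ?\<Omega>. Q x} \<inter> space M)"
        using that unfolding sets\<Omega> by (subst law[symmetric]) (rule emeasure_distr[OF \<phi>])
      also have "?\<phi> -` {x \<in> space ?\<Omega>. Q x} \<inter> space M = {w \<in> space M. Q (?\<phi> w)}"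
        using measurable_space[OF \<phi>] sets_eq_imp_space_eq[OF sets\<Omega>] by auto
      finally show ?thesis .
    qed
    let ?g = "\<lambda>x. smoothed_p_value (K n (S n (first_obs n (fst x)))) (nonconformity_score S A n)
        (nonconformity_score S A n (first_obs n (fst x))) (fst (snd x))"
    let ?W = "\<lambda>x. ((S n (first_obs n (fst x)), later_obs n (fst x)), snd (snd x))"
    have [measurable_cong]: "sets P = sets (Zinf Z)" by (rule sets_P)
    have W: "?W \<in> measurable ?\<Omega> (later_space n)"
      unfolding later_space_def by measurable
    have first: "(\<lambda>x. first_obs n (fst x)) \<in> measurable ?\<Omega>' (Zfin Z n)"
      by (rule measurable_compose[OF measurable_fst measurable_first_obs(1)])
    have g [measurable]: "?g \<in> borel_measurable ?\<Omega>"
      unfolding measurable_cong_sets[OF sets\<Omega> refl]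
      by (rule measurable_smoothed_p_value[OF K[OF n] score_measurable[OF n]
            measurable_compose[OF first S] measurable_compose[OF first score_measurable[OF n]]])
         measurable
    have E: "{x \<in> space ?\<Omega>. ?W x \<in> C} \<in> sets ?\<Omega>"
      using measurable_sets[OF W C] by (simp add: vimage_def Int_def conj_commute)
    have E': "{x \<in> space ?\<Omega>. ?g x \<in> B \<and> ?W x \<in> C} \<in> sets ?\<Omega>"
      by (intro sets.sets_Collect_conj E) measurable
    have "emeasure ?\<Omega> {x \<in> space ?\<Omega>. ?g x \<in> B \<and> ?W x \<in> C}
        = emeasure unif B * emeasure ?\<Omega> {x \<in> space ?\<Omega>. ?W x \<in> C}"
      using smoothed_p_value_uniform_given_later[OF prob_space_P U K_cond_distr[OF n] cond_indep[OF n]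
          score_measurable[OF n] B C[unfolded later_space_def]] .
    then have "emeasure M {w \<in> space M. ?g (?\<phi> w) \<in> B \<and> ?W (?\<phi> w) \<in> C}
        = emeasure unif B * emeasure M {w \<in> space M. ?W (?\<phi> w) \<in> C}"
      unfolding emeasure_law[OF E] emeasure_law[OF E'] .
    moreover have "?W (?\<phi> w) = later_data n (\<zeta> w) (\<tau> w)" for w
      by (simp add: later_data_def)
    moreover have "?g (?\<phi> w) = p n w" if "w \<in> space M" for w
      using p_value_eq_smoothed[OF n \<zeta>_space[OF that]] by (simp add: p_def)
    ultimately show ?thesis by (simp cong: conj_cong)
  qed

  have window: "emeasure M {w \<in> space M. \<forall>i\<in>{m<..m + k}. p i w \<in> B i} = (\<Prod>i\<in>{m<..m + k}. emeasure unif (B i))"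
    if B: "\<And>i. B i \<in> sets borel" for B m k
  proof (induction k arbitrary: m)
    case 0
    then show ?case by (simp add: M.emeasure_space_1)
  next
    case (Suc k)
    have iv: "{m<..m + Suc k} = insert (Suc m) {Suc m<..Suc m + k}" by auto
    obtain C where C: "C \<in> sets (later_space (Suc m))"
      "\<And>z t. z \<in> space (Zinf Z) \<Longrightarrow>
        (\<forall>i\<in>{Suc m<..Suc m + k}. p_value Z S K A i z (t i) \<in> B i) \<longleftrightarrow> later_data (Suc m) z t \<in> C"
      using later_p_values_determined[of "Suc m" B k] B by auto
    have later: "(\<forall>i\<in>{Suc m<..Suc m + k}. p i w \<in> B i) \<longleftrightarrow> later_data (Suc m) (\<zeta> w) (\<tau> w) \<in> C"
      if "w \<in> space M" for w
      unfolding p_def by (rule C(2)[OF \<zeta>_space[OF that]])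
    have "emeasure M {w \<in> space M. \<forall>i\<in>{m<..m + Suc k}. p i w \<in> B i}
        = emeasure M {w \<in> space M. p (Suc m) w \<in> B (Suc m) \<and> later_data (Suc m) (\<zeta> w) (\<tau> w) \<in> C}"
      unfolding iv ball_simps by (rule arg_cong[where f="emeasure M"]) (use later in blast)
    also have "\<dots> = emeasure unif (B (Suc m)) * emeasure M {w \<in> space M. later_data (Suc m) (\<zeta> w) (\<tau> w) \<in> C}"
      using B C(1) by (intro peel) auto
    also have "{w \<in> space M. later_data (Suc m) (\<zeta> w) (\<tau> w) \<in> C}
        = {w \<in> space M. \<forall>i\<in>{Suc m<..Suc m + k}. p i w \<in> B i}"
      using later by blast
    finally show ?case
      unfolding iv Suc.IH by simp
  qed

  have p_seq: "(\<lambda>w. \<lambda>n\<in>{1..}. p n w) \<in> measurable M unif_inf"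
    unfolding unif_inf_def by (intro measurable_restrict) (use p_meas in simp)
  interpret I: product_prob_space "\<lambda>_. unif" "{1::nat..}"
    by (intro product_prob_spaceI prob_space_unif)
  have "distr M unif_inf (\<lambda>w. \<lambda>n\<in>{1..}. p n w) = (\<Pi>\<^sub>M i\<in>{1..}. unif)"
  proof (rule I.PiM_eq)
    show "sets (distr M unif_inf (\<lambda>w. \<lambda>n\<in>{1..}. p n w)) = sets (\<Pi>\<^sub>M i\<in>{1..}. unif)"
      by (simp add: unif_inf_def)
    fix J :: "nat set" and D assume J: "finite J" "J \<subseteq> {1..}" and D: "\<And>j. j \<in> J \<Longrightarrow> D j \<in> sets unif"
    \<comment> \<open>Coordinates outside \<open>J\<close> are left unconstrained, which turns \<open>J\<close> into a window starting at 1.\<close>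
    define B where "B i = (if i \<in> J then D i else UNIV)" for i
    have B: "B i \<in> sets borel" for i using D by (auto simp: B_def)
    obtain N where N: "J \<subseteq> {..N}" using finite_nat_iff_bounded_le J(1) by blast
    have JN: "J \<subseteq> {0<..0 + N}" using N J(2) by fastforce
    have "emeasure (distr M unif_inf (\<lambda>w. \<lambda>n\<in>{1..}. p n w)) (I.emb {1..} J (\<Pi>\<^sub>E j\<in>J. D j))
        = emeasure M ((\<lambda>w. \<lambda>n\<in>{1..}. p n w) -` I.emb {1..} J (\<Pi>\<^sub>E j\<in>J. D j) \<inter> space M)"
      by (rule emeasure_distr[OF p_seq]) (use J D in \<open>auto simp: unif_inf_def intro!: sets_PiM_I\<close>)
    also have "(\<lambda>w. \<lambda>n\<in>{1..}. p n w) -` I.emb {1..} J (\<Pi>\<^sub>E j\<in>J. D j) \<inter> space M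
        = {w \<in> space M. \<forall>i\<in>{0<..0 + N}. p i w \<in> B i}"
      using J(2) JN by (auto simp: prod_emb_def B_def PiE_iff subset_eq)
    also have "emeasure M \<dots> = (\<Prod>i\<in>{0<..0 + N}. emeasure unif (B i))"
      by (rule window[OF B])
    also have "\<dots> = (\<Prod>j\<in>J. emeasure unif (D j))"
      using prob_space.emeasure_space_1[OF prob_space_unif] JN
      by (intro prod.mono_neutral_cong_right) (auto simp: B_def)
    finally show "emeasure (distr M unif_inf (\<lambda>w. \<lambda>n\<in>{1..}. p n w)) (I.emb {1..} J (\<Pi>\<^sub>E j\<in>J. D j))
        = (\<Prod>j\<in>J. emeasure unif (D j))" .
  qed
  then show ?thesis by (simp add: p_def unif_inf_def)
qed

end

theorem theorem1:
  fixes Z :: "'a measure"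
    and \<P> :: "(nat \<Rightarrow> 'a) measure set"
    and T :: "nat \<Rightarrow> 's measure"
    and S :: "nat \<Rightarrow> (nat \<Rightarrow> 'a) \<Rightarrow> 's"
    and K :: "nat \<Rightarrow> 's \<Rightarrow> (nat \<Rightarrow> 'a) measure"
    and A :: "nat \<Rightarrow> 's \<times> 'a \<Rightarrow> real"
    and P :: "(nat \<Rightarrow> 'a) measure"
    and M :: "'w measure"
    and \<zeta> :: "'w \<Rightarrow> nat \<Rightarrow> 'a"
    and \<tau> :: "'w \<Rightarrow> nat \<Rightarrow> real"
  assumes "luzin Z"
    and "statistical_model Z \<P>"
    and "ATTS Z \<P> T S"
    and "\<And>n. n \<ge> 1 \<Longrightarrow> common_cond_distr Z \<P> T S n (K n)"
    and "nonconformity_measure Z T A"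
    and "P \<in> \<P>"
    and "prob_space M"
    and "\<zeta> \<in> measurable M (Zinf Z)" and "distr M (Zinf Z) \<zeta> = P"
    and "\<tau> \<in> measurable M unif_inf" and "distr M unif_inf \<tau> = unif_inf"
    and "indep_elements M (Zinf Z) \<zeta> unif_inf \<tau>"
  shows "distr M unif_inf (\<lambda>w. \<lambda>n\<in>{1..}. p_value Z S K A n (\<zeta> w) (\<tau> w n)) = unif_inf"
proof -
  obtain F :: "nat \<Rightarrow> 's \<times> 'a \<Rightarrow> 's" where F: "\<And>n. n \<ge> 2 \<Longrightarrow> F n \<in> measurable (T (n - 1) \<Otimes>\<^sub>M Z) (T n)"
    "\<And>n z. n \<ge> 2 \<Longrightarrow> z \<in> space (Zfin Z n) \<Longrightarrow> S n z = F n (S (n - 1) (first_obs (n - 1) z), z n)"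
    using assms(3) unfolding ATTS_def algebraically_transitive_def by blast
  have P: "P \<in> space (prob_algebra (Zinf Z))"
    using assms(2,6) by (auto simp: statistical_model_def)
  interpret conformal_prediction Z T S F K A P
  proof (rule conformal_prediction.intro)
    show "S n \<in> measurable (Zfin Z n) (T n)" for n
      using assms(3) by (simp add: ATTS_def statistics_def)
    show "A n \<in> borel_measurable (T (n - 1) \<Otimes>\<^sub>M Z)" if "n \<ge> 1" for n
      using assms(5) that by (simp add: nonconformity_measure_def)
    show "regular_cond_distr P (Zfin Z n) (first_obs n) (T n) (\<lambda>z. S n (first_obs n z)) (K n)"
      if "n \<ge> 1" for n
      using assms(4)[OF that] assms(6) by (simp add: common_cond_distr_def)
    show "cond_indep_var P (Zfin Z n) (first_obs n) (\<Pi>\<^sub>M i\<in>{n<..}. Z) (later_obs n) (T n)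
        (\<lambda>z. S n (first_obs n z))" if "n \<ge> 1" for n
      using assms(3,6) that by (simp add: ATTS_def totally_sufficient_def)
    show "prob_space P" "sets P = sets (Zinf Z)"
      using P by (simp_all add: space_prob_algebra)
  qed (use F in auto)
  show ?thesis
    by (rule p_values_iid_uniform) fact+
qed

end
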